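(* Let $k\geqslant 2$ be an integer and let $F_1(z),\ldots,F_d(z)\in\mathbb{Z}_{\geqslant0}[[z]]$ be $k$-regular functions, $F_i(z)=\sum_{n\geqslant0}f_i(n)z^n$ for $i=1,\ldots,d$, with each $f_i$ not eventually zero. Let $\mathcal{M}$ denote the set of meromorphic functions on $\mathbb{C}$. If the numbers $k,\alpha_{f_1},\ldots,\alpha_{f_d}$ are multiplicatively independent, then $$\operatorname{trdeg}_{\mathbb{C}(z)(\mathcal{M})}\mathbb{C}(z)(\mathcal{M})(F_1(z),\ldots,F_d(z))=d.$$ In particular, $F_1(z),\ldots,F_d(z)$ are algebraically independent over $\mathbb{C}(z)$.
   Context: An integer-valued sequence $\{f(n)\}_{n\geqslant0}$ is $k$-regular if there exist $d\geqslant1$, matrices ${\bf A}_0,\ldots,{\bf A}_{k-1}\in\mathbb{Z}^{d\times d}$ and vectors ${\bf v},{\bf w}\in\mathbb{Z}^d$ with $f(n)={\bf w}^T{\bf A}_{i_0}\cdots{\bf A}_{i_s}{\bf v}$, where $i_s\cdots i_0$ is the base-$k$ expansion of $n$; its generating function is called a $k$-regular function. For a nonnegative integer-valued $k$-regular sequence $f$ that is not eventually zero, $\alpha_f\geqslant1$ denotes the real number such that for some integer $m_f\geqslant0$ and constants $0<c_1\leqslant c_2$ one has $c_1N^{\log_k\alpha_f}\log^{m_f}N\leqslant\sum_{n\leqslant N}f(n)\leqslant c_2N^{\log_k\alpha_f}\log^{m_f}N$ for all large $N$ (such $\alpha_f$ exists and is unique). Numbers are multiplicatively independent if no nontrivial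 product of integer powers of them equals $1$. $\mathbb{C}(z)(\mathcal{M})$ is the field generated over $\mathbb{C}(z)$ by all meromorphic functions on $\mathbb{C}$. *)

theory Defs
  imports
    "HOL-Complex_Analysis.Complex_Analysis"
    "HOL-Library.Poly_Mapping"
    "HOL-Algebra.Generated_Fields"
    "HOL-Algebra.Algebraic_Closure_Type"
    "Jordan_Normal_Form.Matrix"
begin

text \<open>Base-\<open>k\<close> digits, least significant first; the expansion of \<open>0\<close> is the single digit \<open>0\<close>.\<close>

function base_digits :: "nat \<Rightarrow> nat \<Rightarrow> nat list" where
  "base_digits k n = (if k < 2 \<or> n < k then [n] else n mod k # base_digits k (n div k))"
  by auto
termination
  by (relation "Wellfounded.measure snd") auto

declare base_digits.simps [simp del]

definition k_regular :: "nat \<Rightarrow> (nat \<Rightarrow> int) \<Rightarrow> bool" where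
  "k_regular k f \<longleftrightarrow>
     (\<exists>d A v w. d \<ge> 1 \<and> (\<forall>i<k. A i \<in> carrier_mat d d) \<and> v \<in> carrier_vec d \<and> w \<in> carrier_vec d \<and>
        (\<forall>n. f n =
           scalar_prod w (foldr (\<lambda>i M. A i * M) (base_digits k n) (1\<^sub>m d) *\<^sub>v v)))"

definition has_growth_base :: "nat \<Rightarrow> (nat \<Rightarrow> int) \<Rightarrow> real \<Rightarrow> bool" where
  "has_growth_base k f \<alpha> \<longleftrightarrow> \<alpha> \<ge> 1 \<and>
     (\<exists>(m::nat) c1 c2. 0 < c1 \<and> c1 \<le> c2 \<and>
        (\<forall>\<^sub>F N in sequentially.
           c1 * real N powr log (real k) \<alpha> * ln (real N) ^ m \<le> (\<Sum>n\<le>N. real_of_int (f n)) \<and>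
           (\<Sum>n\<le>N. real_of_int (f n)) \<le> c2 * real N powr log (real k) \<alpha> * ln (real N) ^ m))"

definition growth_base :: "nat \<Rightarrow> (nat \<Rightarrow> int) \<Rightarrow> real" where
  "growth_base k f = (THE \<alpha>. has_growth_base k f \<alpha>)"

definition mult_independent :: "'i set \<Rightarrow> ('i \<Rightarrow> real) \<Rightarrow> bool" where
  "mult_independent I x \<longleftrightarrow>
     (\<forall>e :: 'i \<Rightarrow> int. (\<Prod>i\<in>I. x i powi e i) = 1 \<longrightarrow> (\<forall>i\<in>I. e i = 0))"

text \<open>Polynomials in variables indexed by \<open>'i\<close> are finitely supported maps from exponent
  vectors to coefficients.\<close>

definition mpoly_eval ::
    "('i \<Rightarrow> 'a::field) \<Rightarrow> (('i \<Rightarrow>\<^sub>0 nat) \<Rightarrow>\<^sub>0 'a) \<Rightarrow> 'a" where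
  "mpoly_eval x p =
     (\<Sum>e\<in>Poly_Mapping.keys p. Poly_Mapping.lookup p e *
        (\<Prod>i\<in>Poly_Mapping.keys e. x i ^ Poly_Mapping.lookup e i))"

definition alg_independent :: "'a::field set \<Rightarrow> 'i set \<Rightarrow> ('i \<Rightarrow> 'a) \<Rightarrow> bool" where
  "alg_independent K I x \<longleftrightarrow>
     (\<forall>p :: ('i \<Rightarrow>\<^sub>0 nat) \<Rightarrow>\<^sub>0 'a.
        (\<forall>e\<in>Poly_Mapping.keys p. Poly_Mapping.lookup p e \<in> K \<and> Poly_Mapping.keys e \<subseteq> I) \<longrightarrow>
        mpoly_eval x p = 0 \<longrightarrow> p = 0)"

definition field_adjoin :: "'a::field set \<Rightarrow> 'a set \<Rightarrow> 'a set" where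
  "field_adjoin K S = generate_field ring_of_type_algebra (K \<union> S)"

text \<open>The transcendence degree of a field \<open>L\<close> over a subfield \<open>K\<close>, both given as subsets of
  an ambient field: the largest cardinality of an algebraically independent subset.\<close>

definition trdeg :: "'a::field set \<Rightarrow> 'a set \<Rightarrow> enat" where
  "trdeg K L = (SUP S\<in>{S. finite S \<and> S \<subseteq> L \<and> alg_independent K S (\<lambda>s. s)}. enat (card S))"

text \<open>The common ambient field is the field of formal Laurent series at \<open>0\<close>. A meromorphic
  function on \<open>\<complex>\<close> is identified with its Laurent expansion at \<open>0\<close>, which determines it
  up to its values on a discrete set.\<close>

definition gen_fun :: "(nat \<Rightarrow> int) \<Rightarrow> complex fls" where
  "gen_fun f = fps_to_fls (Abs_fps (\<lambda>n. of_int (f n)))"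

definition rational_functions :: "complex fls set" where
  "rational_functions =
     {fps_to_fls (fps_of_poly p) / fps_to_fls (fps_of_poly q) | p q. q \<noteq> 0}"

definition meromorphic_functions :: "complex fls set" where
  "meromorphic_functions = {laurent_expansion g 0 | g. g meromorphic_on UNIV}"

end

theory Submission
  imports Defs "HOL-Real_Asymp.Real_Asymp"
begin

text \<open>
  Write \<open>S(N) = f(0) + \<dots> + f(N)\<close> for a nonnegative \<open>k\<close>-regular sequence \<open>f\<close>. The numbers
  \<open>S(k\<^sup>j - 1)\<close> form a monotone linear recurrence in \<open>j\<close>, so they have exact order
  \<open>\<alpha>\<^sup>j j\<^sup>m\<close>; this gives existence and uniqueness of the growth base \<open>\<alpha>\<close>, and an Abelian argument
  shows \<open>log F(x) / log (1 / (1 - x)) \<longlongrightarrow> log\<^sub>k \<alpha>\<close> as \<open>x\<close> increases to \<open>1\<close>. By the Weierstrass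
  factorisation theorem an algebraic relation over the meromorphic functions can be cleared to one
  with entire coefficients, which have integer order at \<open>1\<close>. If \<open>k, \<alpha>\<^sub>1, \<dots>, \<alpha>\<^sub>d\<close> are
  multiplicatively independent, the terms of the relation have pairwise distinct orders at \<open>1\<close>,
  so the dominant one cannot cancel.
\<close>

subsection \<open>Subfields and linear systems\<close>

text \<open>The two-sided growth bounds allow bounded oscillation and carry a factor
  \<open>log^m\<close>, so no asymptotic formula for F near 1 is available. The quotient
  \<open>ln F(x) / ln (1 / (1 - x))\<close> forgets both, yet stays additive under products, and
  that is all that is needed to separate monomials. Nonnegative coefficients make the real point 1
  the right place to look and let crude comparisons suffice. An entire coefficient contributes minus
  its multiplicity of vanishing at 1. This uncontrolled integer is why k belongs to the independent
  family: a coincidence of two orders reads \<open>n + e_1 log_k alpha_1 + ... = 0\<close>, that is,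
  \<open>k^n alpha_1^e_1 ... = 1\<close>. In the growth estimate the obstacle is that several
  complex roots may share the largest modulus and cancel each other; monotonicity of the partial
  sums restores a lower bound. Independence of the F_i gives only one half of the transcendence
  degree: \<open>trdeg\<close> is a supremum over all finite independent sets, so a dimension count
  must also exclude more than d independent elements.\<close>

definition is_subfield :: "'a::field set \<Rightarrow> bool" where
  "is_subfield K \<longleftrightarrow> 1 \<in> K \<and> (\<forall>x\<in>K. \<forall>y\<in>K. x + y \<in> K \<and> x * y \<in> K) \<and> (\<forall>x\<in>K. - x \<in> K \<and> inverse x \<in> K)"

lemma is_subfield_UNIV: "is_subfield UNIV"
  by (simp add: is_subfield_def)

lemma
  assumes "is_subfield K"
  shows is_subfield_1: "1 \<in> K"
    and is_subfield_0: "0 \<in> K"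
    and is_subfield_add: "x \<in> K \<Longrightarrow> y \<in> K \<Longrightarrow> x + y \<in> K"
    and is_subfield_mult: "x \<in> K \<Longrightarrow> y \<in> K \<Longrightarrow> x * y \<in> K"
    and is_subfield_uminus: "x \<in> K \<Longrightarrow> - x \<in> K"
    and is_subfield_diff: "x \<in> K \<Longrightarrow> y \<in> K \<Longrightarrow> x - y \<in> K"
    and is_subfield_divide: "x \<in> K \<Longrightarrow> y \<in> K \<Longrightarrow> x / y \<in> K"
proof -
  show 1: "1 \<in> K" and add: "x \<in> K \<Longrightarrow> y \<in> K \<Longrightarrow> x + y \<in> K"
    and mult: "x \<in> K \<Longrightarrow> y \<in> K \<Longrightarrow> x * y \<in> K" and uminus: "x \<in> K \<Longrightarrow> - x \<in> K" for x y
    using assms by (auto simp: is_subfield_def)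
  have inverse: "x \<in> K \<Longrightarrow> inverse x \<in> K" for x using assms by (auto simp: is_subfield_def)
  show "0 \<in> K" using add[OF 1 uminus[OF 1]] by simp
  show "x \<in> K \<Longrightarrow> y \<in> K \<Longrightarrow> x - y \<in> K" using add[OF _ uminus, of x y] by simp
  show "x \<in> K \<Longrightarrow> y \<in> K \<Longrightarrow> x / y \<in> K" using mult[OF _ inverse, of x y] by (simp add: field_simps)
qed

lemma is_subfield_sum:
  assumes "is_subfield K" "\<And>i. i \<in> I \<Longrightarrow> g i \<in> K"
  shows "(\<Sum>i\<in>I. g i) \<in> K"
  using assms(2) by (induction I rule: infinite_finite_induct)
    (auto intro: is_subfield_0[OF assms(1)] is_subfield_add[OF assms(1)])

text \<open>Gaussian elimination by induction on the equations, carried out inside \<open>K\<close>.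
  A solution with entries in \<open>K\<close>, a mere subset of the ambient field, is what an
  algebraic relation over \<open>K\<close> requires; with \<open>K = UNIV\<close> the lemma also
  produces linear recurrences.\<close>

lemma homogeneous_system_nontrivial_solution:
  fixes A :: "'e \<Rightarrow> 'u \<Rightarrow> 'a::field"
  assumes K: "is_subfield K"
    and "finite E" "finite U" "card E < card U" "\<And>e u. e \<in> E \<Longrightarrow> u \<in> U \<Longrightarrow> A e u \<in> K"
  shows "\<exists>c. (\<forall>u. c u \<in> K) \<and> (\<exists>u\<in>U. c u \<noteq> 0) \<and> (\<forall>e\<in>E. (\<Sum>u\<in>U. A e u * c u) = 0)"
  using assms(2-)
proof (induction E arbitrary: U A rule: finite_induct)
  case empty
  then have "U \<noteq> {}" by auto
  then show ?case
    using is_subfield_1[OF K] by (intro exI[of _ "\<lambda>_. 1"]) auto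
next
  case (insert e E)
  show ?case
  proof (cases "\<forall>u\<in>U. A e u = 0")
    case True
    have "\<exists>c. (\<forall>u. c u \<in> K) \<and> (\<exists>u\<in>U. c u \<noteq> 0) \<and> (\<forall>e\<in>E. (\<Sum>u\<in>U. A e u * c u) = 0)"
      using insert.prems insert.hyps by (intro insert.IH) auto
    moreover have "(\<Sum>u\<in>U. A e u * c u) = 0" for c
      using True by (intro sum.neutral) auto
    ultimately show ?thesis by auto
  next
    case False
    then obtain u0 where u0: "u0 \<in> U" "A e u0 \<noteq> 0" by auto
    define V where "V = U - {u0}"
    have U: "U = insert u0 V" "u0 \<notin> V" "finite V" using u0 insert.prems by (auto simp: V_def)
    \<comment> \<open>Subtracting a multiple of equation \<open>e\<close> from every other equation
      removes the pivot unknown \<open>u0\<close>.\<close>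
    define A' where "A' = (\<lambda>e' u. A e' u - A e' u0 * A e u / A e u0)"
    have "\<exists>c. (\<forall>u. c u \<in> K) \<and> (\<exists>u\<in>V. c u \<noteq> 0) \<and> (\<forall>e\<in>E. (\<Sum>u\<in>V. A' e u * c u) = 0)"
    proof (rule insert.IH)
      show "card E < card V" using insert.prems insert.hyps U by simp
      show "A' e' u \<in> K" if "e' \<in> E" "u \<in> V" for e' u
        unfolding A'_def using that U insert.prems(3)
        by (intro is_subfield_diff is_subfield_divide is_subfield_mult K) auto
    qed (use U in auto)
    then obtain c where c: "\<And>u. c u \<in> K" "\<exists>u\<in>V. c u \<noteq> 0" "\<And>e. e \<in> E \<Longrightarrow> (\<Sum>u\<in>V. A' e u * c u) = 0"
      by auto
    \<comment> \<open>Back substitution: the value of the pivot unknown that makes equation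
      \<open>e\<close> hold.\<close>
    define c0 where "c0 = - (\<Sum>u\<in>V. A e u * c u) / A e u0"
    have c0K: "c0 \<in> K" unfolding c0_def using U insert.prems(3) c(1)
      by (intro is_subfield_divide is_subfield_uminus is_subfield_sum is_subfield_mult K) auto
    define c' where "c' = c(u0 := c0)"
    have S: "(\<Sum>u\<in>U. A e' u * c' u) = A e' u0 * c0 + (\<Sum>u\<in>V. A e' u * c u)" for e'
    proof -
      have "(\<Sum>u\<in>V. A e' u * c' u) = (\<Sum>u\<in>V. A e' u * c u)"
        using U by (intro sum.cong) (auto simp: c'_def)
      then show ?thesis using U by (simp add: c'_def)
    qed
    have "(\<Sum>u\<in>U. A e' u * c' u) = 0" if "e' \<in> insert e E" for e'
    proof (cases "e' = e")
      case True
      then show ?thesis unfolding S c0_def using u0 by simp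
    next
      case False
      then have "0 = (\<Sum>u\<in>V. A' e' u * c u)" using c(3) that by simp
      also have "\<dots> = (\<Sum>u\<in>V. A e' u * c u - (A e' u0 / A e u0) * (A e u * c u))"
        by (intro sum.cong) (auto simp: A'_def algebra_simps)
      also have "\<dots> = (\<Sum>u\<in>V. A e' u * c u) - (A e' u0 / A e u0) * (\<Sum>u\<in>V. A e u * c u)"
        by (simp add: sum_subtractf sum_distrib_left)
      also have "\<dots> = A e' u0 * c0 + (\<Sum>u\<in>V. A e' u * c u)"
        by (simp add: c0_def)
      finally show ?thesis unfolding S by simp
    qed
    moreover have "\<forall>u. c' u \<in> K" using c(1) c0K by (simp add: c'_def)
    moreover have "\<exists>u\<in>U. c' u \<noteq> 0" using c(2) U by (auto simp: c'_def)
    ultimately show ?thesis by blast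
  qed
qed

section \<open>Fields generated inside an ambient field\<close>

text \<open>Inverses in the record structure are definite descriptions, so they must be identified
  with the type-class operations before \<open>generate_field\<close> can be combined with ordinary
  arithmetic.\<close>

lemma uminus_ring_of_type_algebra: "\<ominus>\<^bsub>ring_of_type_algebra\<^esub> y = - (y::'a::field)"
proof -
  have "ring (ring_of_type_algebra :: 'a ring)" by (rule ring_from_type_algebra)
  then have "abelian_group (ring_of_type_algebra :: 'a ring)" by (rule ring.is_abelian_group)
  then show ?thesis
    by (rule abelian_group.minus_equality) (simp_all add: ring_of_type_algebra_def)
qed

lemma inverse_ring_of_type_algebra:
  assumes "y \<noteq> 0"
  shows "inv\<^bsub>ring_of_type_algebra\<^esub> y = inverse (y::'a::field)"
proof -
  have "Ring.field (ring_of_type_algebra :: 'a ring)" by (rule field_from_type_algebra)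
  then have "Group.comm_monoid (ring_of_type_algebra :: 'a ring)"
    by (intro cring.axioms domain.axioms field.axioms)
  then show ?thesis
    by (rule comm_monoid.comm_inv_char) (use assms in \<open>simp_all add: ring_of_type_algebra_def\<close>)
qed

text \<open>Serves to bring every element of an adjoined field into a normal form as a quotient,
  with all operations those of the type class.\<close>

lemma field_adjoin_induct [consumes 1, case_names one base uminus inverse add mult]:
  assumes "x \<in> field_adjoin K S"
    and "P 1" "\<And>x. x \<in> K \<union> S \<Longrightarrow> P x" "\<And>x. P x \<Longrightarrow> P (- x)" "\<And>x. P x \<Longrightarrow> x \<noteq> 0 \<Longrightarrow> P (inverse x)"
    "\<And>x y. P x \<Longrightarrow> P y \<Longrightarrow> P (x + y)" "\<And>x y. P x \<Longrightarrow> P y \<Longrightarrow> P (x * y)"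
  shows "P x"
proof -
  note um = uminus_ring_of_type_algebra and inv = inverse_ring_of_type_algebra
  have "x \<in> generate_field ring_of_type_algebra (K \<union> S)"
    using assms(1) by (simp add: field_adjoin_def)
  then show ?thesis
  proof (induction rule: generate_field.induct)
    case one
    then show ?case using assms(2) by (simp add: ring_of_type_algebra_def)
  next
    case (incl h)
    then show ?case using assms(3) by simp
  next
    case (a_inv h)
    then show ?case using assms(4) by (simp only: um)
  next
    case (m_inv h)
    then have "h \<noteq> 0" by (simp add: ring_of_type_algebra_def)
    then show ?case using assms(5) m_inv by (simp only: inv not_False_eq_True)
  next
    case (eng_add h1 h2)
    then show ?case using assms(6) by (simp add: ring_of_type_algebra_def)
  next
    case (eng_mult h1 h2)
    then show ?case using assms(7) by (simp add: ring_of_type_algebra_def)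
  qed
qed

lemma field_adjoin_superset: "K \<union> S \<subseteq> field_adjoin K S"
  by (auto simp: field_adjoin_def intro: generate_field.incl)

lemma is_subfield_field_adjoin: "is_subfield (field_adjoin K S)"
proof -
  note um = uminus_ring_of_type_algebra and inv = inverse_ring_of_type_algebra
  let ?G = "generate_field ring_of_type_algebra (K \<union> S)"
  have 1: "1 \<in> ?G" using generate_field.one[of ring_of_type_algebra "K \<union> S"]
    by (simp add: ring_of_type_algebra_def)
  have add: "x + y \<in> ?G" if "x \<in> ?G" "y \<in> ?G" for x y
    using generate_field.eng_add[OF that] by (simp add: ring_of_type_algebra_def)
  have mult: "x * y \<in> ?G" if "x \<in> ?G" "y \<in> ?G" for x y
    using generate_field.eng_mult[OF that] by (simp add: ring_of_type_algebra_def)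
  have uminus: "- x \<in> ?G" if "x \<in> ?G" for x
    using generate_field.a_inv[OF that] by (simp only: um)
  have inverse: "inverse x \<in> ?G" if "x \<in> ?G" for x
  proof (cases "x = 0")
    case False
    then have "x \<noteq> \<zero>\<^bsub>ring_of_type_algebra\<^esub>" by (simp add: ring_of_type_algebra_def)
    from generate_field.m_inv[OF that this] show ?thesis using False by (simp only: inv not_False_eq_True)
  qed (use that in simp)
  show ?thesis unfolding is_subfield_def field_adjoin_def
    by (intro conjI ballI 1 add mult uminus inverse)
qed

subsection \<open>Linear recurrences\<close>

text \<open>This is \<open>p(E)\<close> applied to \<open>a\<close>, where \<open>E\<close> is the
  shift operator. A linear recurrence is the vanishing of \<open>p(E) a\<close>, and
  \<open>p\<close> is its characteristic polynomial.\<close>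

definition shift_poly :: "complex poly \<Rightarrow> (nat \<Rightarrow> complex) \<Rightarrow> nat \<Rightarrow> complex" where
  "shift_poly p a n = (\<Sum>i\<le>Polynomial.degree p. poly.coeff p i * a (n + i))"

lemma shift_poly_altdef:
  assumes "Polynomial.degree p \<le> N"
  shows "shift_poly p a n = (\<Sum>i\<le>N. poly.coeff p i * a (n + i))"
  unfolding shift_poly_def using assms
  by (intro sum.mono_neutral_left) (auto simp: coeff_eq_0)

lemma shift_poly_0 [simp]: "shift_poly 0 a n = 0"
  by (simp add: shift_poly_def)

lemma shift_poly_pCons: "shift_poly (pCons c p) a n = c * a n + shift_poly p a (Suc n)"
proof -
  have "shift_poly (pCons c p) a n = (\<Sum>i\<le>Suc (Polynomial.degree p). poly.coeff (pCons c p) i * a (n + i))"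
    by (intro shift_poly_altdef) (rule degree_pCons_le)
  then show ?thesis
    by (simp add: sum.atMost_Suc_shift shift_poly_def del: sum.atMost_Suc)
qed

lemma shift_poly_add: "shift_poly (p + q) a n = shift_poly p a n + shift_poly q a n"
proof -
  define N where "N = max (Polynomial.degree p) (Polynomial.degree q)"
  have "Polynomial.degree p \<le> N" "Polynomial.degree q \<le> N" "Polynomial.degree (p + q) \<le> N"
    by (auto simp: N_def intro: degree_add_le)
  then show ?thesis by (simp add: shift_poly_altdef[of _ N] algebra_simps sum.distrib)
qed

lemma shift_poly_smult: "shift_poly (Polynomial.smult c p) a n = c * shift_poly p a n"
  using degree_smult_le[of c p]
  by (simp add: shift_poly_altdef[of _ "Polynomial.degree p"] sum_distrib_left mult.assoc)

lemma shift_poly_sum: "shift_poly (\<Sum>i\<in>I. P i) a n = (\<Sum>i\<in>I. shift_poly (P i) a n)"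
  by (induction I rule: infinite_finite_induct) (auto simp: shift_poly_add)

text \<open>Substituting the shift is a ring homomorphism, so factoring a polynomial factors the
  recurrence; the separation of roots rests on this.\<close>

lemma shift_poly_mult: "shift_poly (p * q) a n = shift_poly p (shift_poly q a) n"
proof (induction p arbitrary: n)
  case (pCons c p)
  then show ?case
    by (simp add: shift_poly_pCons shift_poly_add shift_poly_smult)
qed simp

lemma shift_poly_1 [simp]: "shift_poly 1 a n = a n"
  by (simp add: shift_poly_def)

lemma shift_poly_monom: "shift_poly (Polynomial.monom c N) a n = c * a (n + N)"
proof -
  have "shift_poly (Polynomial.monom c N) a n = (\<Sum>i\<le>N. if i = N then c * a (n + N) else 0)"
    unfolding shift_poly_altdef[OF degree_monom_le] by (intro sum.cong) auto
  then show ?thesis by simp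
qed

text \<open>Binomial expansion of the shift \<open>E = l + (E - l)\<close>, where \<open>E - l\<close> is nilpotent on \<open>a\<close>.\<close>

lemma shift_poly_binomial:
  assumes "\<And>n. shift_poly ([:-l, 1:] ^ r) a n = 0"
  shows "a N = (\<Sum>j<r. of_nat (N choose j) * l ^ (N - j) * shift_poly ([:-l, 1:] ^ j) a 0)"
proof -
  let ?t = "\<lambda>j. of_nat (N choose j) * l ^ (N - j) * shift_poly ([:-l, 1:] ^ j) a 0"
  have "Polynomial.monom (1::complex) N = ([:-l, 1:] + [:l:]) ^ N"
    by (simp add: monom_altdef)
  also have "\<dots> = (\<Sum>j\<le>N. of_nat (N choose j) * [:-l, 1:] ^ j * [:l:] ^ (N - j))"
    by (rule binomial_ring)
  also have "\<dots> = (\<Sum>j\<le>N. Polynomial.smult (of_nat (N choose j) * l ^ (N - j)) ([:-l, 1:] ^ j))"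
    by (intro sum.cong) (simp_all add: poly_const_pow of_nat_poly mult_ac)
  finally have "a N = (\<Sum>j\<le>N. ?t j)"
    using shift_poly_monom[of 1 N a 0] by (simp add: shift_poly_sum shift_poly_smult)
  also have "\<dots> = (\<Sum>j\<le>N + r. ?t j)"
    by (intro sum.mono_neutral_left) auto
  also have "\<dots> = (\<Sum>j<r. ?t j)"
  proof (intro sum.mono_neutral_right)
    show "\<forall>j\<in>{..N + r} - {..<r}. ?t j = 0"
    proof
      fix j assume "j \<in> {..N + r} - {..<r}"
      then have "[:-l, 1:] ^ j = [:-l, 1:] ^ (j - r) * [:-l, 1:] ^ r"
        by (simp flip: power_add)
      then have "shift_poly ([:-l, 1:] ^ j) a 0 = 0"
        using assms by (simp only: shift_poly_mult) (simp add: shift_poly_def)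
      then show "?t j = 0" by simp
    qed
  qed auto
  finally show ?thesis .
qed

section \<open>Upper bounds for solutions of linear recurrences\<close>

lemma power_times_geometric_bounded:
  fixes x :: real
  assumes "0 < x" "x < 1"
  shows "\<exists>C\<ge>0. \<forall>N. real N ^ j * x ^ N \<le> C"
proof -
  have "(\<lambda>N. real N ^ j * x ^ N) \<longlonglongrightarrow> 0"
    using assms by real_asymp
  then have "Bseq (\<lambda>N. real N ^ j * x ^ N)"
    by (intro convergent_imp_Bseq convergentI)
  then obtain C where "C > 0" "\<And>N. norm (real N ^ j * x ^ N) \<le> C"
    by (auto simp: Bseq_def)
  then show ?thesis using assms by (intro exI[of _ C]) (auto simp: abs_mult)
qed

text \<open>For \<open>r = \<alpha>\<close> the binomial coefficient grows like a power
  \<open>j <= m\<close> of \<open>N\<close>; for \<open>r < \<alpha>\<close> the geometric gap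
  absorbs any power. Where \<open>N - j\<close> is truncated, the binomial coefficient is
  zero.\<close>

lemma binomial_times_power_bound:
  fixes r \<alpha> :: real
  assumes "\<alpha> > 0" "0 \<le> r" "r < \<alpha> \<or> r = \<alpha> \<and> j \<le> m"
  shows "\<exists>C\<ge>0. \<forall>N. real (N choose j) * r ^ (N - j) \<le> C * (\<alpha> ^ N * real (N + 1) ^ m)"
proof -
  have choose_le: "real (N choose j) \<le> real N ^ j" for N
  proof -
    have "N choose j \<le> N ^ j"
      by (cases "j \<le> N") (auto intro: binomial_le_pow simp: binomial_eq_0)
    then show ?thesis by (metis of_nat_le_iff of_nat_power)
  qed
  show ?thesis
  proof (cases "r = \<alpha>")
    case True
    have "real (N choose j) * r ^ (N - j) \<le> 1 / \<alpha> ^ j * (\<alpha> ^ N * real (N + 1) ^ m)" for N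
    proof (cases "j \<le> N")
      case True
      have "real (N choose j) \<le> real N ^ j" by (rule choose_le)
      also have "\<dots> \<le> real (N + 1) ^ j" by (intro power_mono) auto
      also have "\<dots> \<le> real (N + 1) ^ m"
        using assms \<open>r = \<alpha>\<close> by (intro power_increasing) auto
      finally have "real (N choose j) * \<alpha> ^ (N - j) \<le> real (N + 1) ^ m * \<alpha> ^ (N - j)"
        using assms by (intro mult_right_mono) auto
      moreover have "\<alpha> ^ (N - j) = \<alpha> ^ N / \<alpha> ^ j" using True assms by (simp add: power_diff)
      ultimately show ?thesis using \<open>r = \<alpha>\<close> by (simp add: mult_ac)
    qed (use assms in \<open>auto simp: binomial_eq_0\<close>)
    then show ?thesis using assms by (intro exI[of _ "1 / \<alpha> ^ j"]) auto
  next
    case False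
    \<comment> \<open>Taking at least \<open>\<alpha> / 2\<close> keeps this positive even when
      \<open>r = 0\<close>, so that \<open>\<mu> ^ j\<close> can be divided out.\<close>
    define \<mu> where "\<mu> = max r (\<alpha> / 2)"
    have \<mu>: "\<mu> > 0" "r \<le> \<mu>" "\<mu> < \<alpha>" using assms False by (auto simp: \<mu>_def)
    then obtain C where C: "C \<ge> 0" "\<And>N. real N ^ j * (\<mu> / \<alpha>) ^ N \<le> C"
      using power_times_geometric_bounded[of "\<mu> / \<alpha>" j] assms by auto
    have "real (N choose j) * r ^ (N - j) \<le> C / \<mu> ^ j * (\<alpha> ^ N * real (N + 1) ^ m)" for N
    proof (cases "j \<le> N")
      case True
      have "real (N choose j) * r ^ (N - j) \<le> real N ^ j * \<mu> ^ (N - j)"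
        using assms \<mu> choose_le by (intro mult_mono power_mono) auto
      also have "\<dots> = real N ^ j * (\<mu> / \<alpha>) ^ N * (\<alpha> ^ N / \<mu> ^ j)"
        using True assms \<mu> by (simp add: power_diff power_divide)
      also have "\<dots> \<le> C * (\<alpha> ^ N / \<mu> ^ j)"
        using assms \<mu> by (intro mult_right_mono C) auto
      also have "\<dots> = C / \<mu> ^ j * (\<alpha> ^ N * 1)" by simp
      also have "\<dots> \<le> C / \<mu> ^ j * (\<alpha> ^ N * real (N + 1) ^ m)"
        using assms \<mu> C by (intro mult_left_mono one_le_power) auto
      finally show ?thesis .
    qed (use assms \<mu> C in \<open>auto simp: binomial_eq_0\<close>)
    then show ?thesis using C \<mu> by (intro exI[of _ "C / \<mu> ^ j"]) auto
  qed
qed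

text \<open>With a single root the binomial expansion has the terms \<open>j < r\<close>; the
  condition \<open>r <= Suc m\<close> says that each such \<open>j\<close> is at most
  \<open>m\<close>.\<close>

lemma primary_recurrence_bound:
  assumes "\<And>n. shift_poly ([:-l, 1:] ^ r) a n = 0" "\<alpha> > 0"
    and "norm l < \<alpha> \<or> norm l = \<alpha> \<and> r \<le> Suc m"
  shows "\<exists>C. \<forall>N. norm (a N) \<le> C * (\<alpha> ^ N * real (N + 1) ^ m)"
proof -
  have "\<forall>j\<in>{..<r}. \<exists>C\<ge>0. \<forall>N. real (N choose j) * norm l ^ (N - j) \<le> C * (\<alpha> ^ N * real (N + 1) ^ m)"
    using assms by (intro ballI binomial_times_power_bound) auto
  then obtain C where C: "\<And>j N. j < r \<Longrightarrow> real (N choose j) * norm l ^ (N - j) \<le> C j * (\<alpha> ^ N * real (N + 1) ^ m)"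
    by (metis lessThan_iff)
  define h where "h = (\<lambda>j. shift_poly ([:-l, 1:] ^ j) a 0)"
  have "norm (a N) \<le> (\<Sum>j<r. C j * norm (h j)) * (\<alpha> ^ N * real (N + 1) ^ m)" for N
  proof -
    have "norm (a N) \<le> (\<Sum>j<r. norm (of_nat (N choose j) * l ^ (N - j) * h j))"
      unfolding shift_poly_binomial[OF assms(1), of N] h_def by (rule norm_sum)
    also have "\<dots> = (\<Sum>j<r. (real (N choose j) * norm l ^ (N - j)) * norm (h j))"
      by (simp add: norm_mult norm_power)
    also have "\<dots> \<le> (\<Sum>j<r. (C j * (\<alpha> ^ N * real (N + 1) ^ m)) * norm (h j))"
      by (intro sum_mono mult_right_mono C) auto
    also have "\<dots> = (\<Sum>j<r. C j * norm (h j)) * (\<alpha> ^ N * real (N + 1) ^ m)"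
      unfolding sum_distrib_right by (intro sum.cong) (simp_all add: mult_ac)
    finally show ?thesis .
  qed
  then show ?thesis by blast
qed

lemma bezout_linear_power:
  fixes q :: "complex poly"
  assumes "\<not> [:-l, 1:] dvd q"
  shows "\<exists>u v. u * [:-l, 1:] ^ r + v * q = 1"
proof -
  have "coprime [:-l, 1:] q"
    using assms by (intro prime_elem_imp_coprime prime_elem_linear_field_poly) auto
  then have "coprime ([:-l, 1:] ^ r) q" by simp
  then have "gcd ([:-l, 1:] ^ r) q = 1" by simp
  then show ?thesis by (metis bezout_coefficients_fst_snd)
qed

text \<open>Induction on the degree: a Bezout identity splits off the full power of one root and
  writes \<open>a\<close> as a sum of solutions of two coprime recurrences, so no closed formula is
  needed. The weight \<open>N + 1\<close> does not vanish at \<open>N = 0\<close>.\<close>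

lemma recurrence_upper_bound:
  assumes "p \<noteq> 0" "\<And>n. shift_poly p a n = 0" "\<alpha> > 0"
    and "\<And>l. poly p l = 0 \<Longrightarrow> norm l < \<alpha> \<or> norm l = \<alpha> \<and> Polynomial.order l p \<le> Suc m"
  shows "\<exists>C. \<forall>N. norm (a N) \<le> C * (\<alpha> ^ N * real (N + 1) ^ m)"
  using assms(1,2,4)
proof (induction "Polynomial.degree p" arbitrary: p a rule: less_induct)
  case less
  show ?case
  proof (cases "Polynomial.degree p = 0")
    case True
    then obtain c where "p = [:c:]" by (rule degree_eq_zeroE)
    then have "a n = 0" for n using less.prems(1) less.prems(2)[of n] by (auto simp: shift_poly_pCons)
    then show ?thesis by (intro exI[of _ 0]) auto
  next
    case False
    then obtain l where l: "poly p l = 0"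
      using fundamental_theorem_of_algebra[of p] constant_degree[of p] by auto
    define r where "r = Polynomial.order l p"
    obtain q where q: "p = [:-l, 1:] ^ r * q" "\<not> [:-l, 1:] dvd q"
      using order_decomp[OF less.prems(1), of l] by (auto simp: r_def)
    have "r > 0" using l less.prems(1) by (simp add: r_def order_gt_0_iff)
    have q0: "q \<noteq> 0" using q less.prems(1) by auto
    obtain u v where uv: "u * [:-l, 1:] ^ r + v * q = 1"
      using bezout_linear_power[OF q(2)] by blast
    \<comment> \<open>\<open>q\<close> annihilates \<open>a1\<close> and the power of the linear
      factor annihilates \<open>a2\<close>, since in both cases the product is a multiple of
      \<open>p\<close>.\<close>
    define a1 where "a1 = shift_poly (u * [:-l, 1:] ^ r) a"
    define a2 where "a2 = shift_poly (v * q) a"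
    have a: "a N = a1 N + a2 N" for N
      unfolding a1_def a2_def using uv by (simp flip: shift_poly_add)
    have multp: "shift_poly (s * p) a n = 0" for s n
      by (simp add: shift_poly_mult shift_poly_def[of s] less.prems(2))
    have "\<exists>C. \<forall>N. norm (a1 N) \<le> C * (\<alpha> ^ N * real (N + 1) ^ m)"
    proof (rule less.hyps)
      have "Polynomial.degree p = r + Polynomial.degree q"
        unfolding q(1) using q0 by (simp add: degree_mult_eq degree_power_eq)
      then show "Polynomial.degree q < Polynomial.degree p" using \<open>r > 0\<close> by simp
      show "shift_poly q a1 n = 0" for n
        unfolding a1_def using multp[of u n] by (simp add: q(1) mult_ac flip: shift_poly_mult)
      show "norm x < \<alpha> \<or> norm x = \<alpha> \<and> Polynomial.order x q \<le> Suc m" if "poly q x = 0" for x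
      proof -
        have "Polynomial.order x q \<le> Polynomial.order x p"
          using less.prems(1) unfolding q(1) by (subst order_mult) auto
        then show ?thesis using less.prems(3)[of x] that unfolding q(1) by fastforce
      qed
    qed fact
    then obtain C1 where C1: "\<And>N. norm (a1 N) \<le> C1 * (\<alpha> ^ N * real (N + 1) ^ m)" by blast
    have "\<exists>C. \<forall>N. norm (a2 N) \<le> C * (\<alpha> ^ N * real (N + 1) ^ m)"
    proof (rule primary_recurrence_bound)
      show "shift_poly ([:-l, 1:] ^ r) a2 n = 0" for n
        unfolding a2_def using multp[of v n] by (simp add: q(1) mult_ac flip: shift_poly_mult)
    qed (use assms(3) less.prems(3)[OF l] in \<open>auto simp: r_def\<close>)
    then obtain C2 where C2: "\<And>N. norm (a2 N) \<le> C2 * (\<alpha> ^ N * real (N + 1) ^ m)" by blast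
    have "norm (a N) \<le> (C1 + C2) * (\<alpha> ^ N * real (N + 1) ^ m)" for N
      unfolding a distrib_right by (intro norm_triangle_mono C1 C2)
    then show ?thesis by blast
  qed
qed

section \<open>Exact growth of monotone recurrences\<close>

lemma binomial_over_power_tendsto: "(\<lambda>N. real (N choose j) / real N ^ j) \<longlonglongrightarrow> 1 / fact j"
proof (induction j)
  case (Suc j)
  have "(\<lambda>N. real (N choose j) / real N ^ j * ((real N - real j) / real N / real (Suc j)))
          \<longlonglongrightarrow> 1 / fact j * (1 / real (Suc j))"
    by (intro tendsto_mult Suc) (real_asymp simp: field_simps)
  moreover have "eventually (\<lambda>N. real (N choose j) / real N ^ j * ((real N - real j) / real N / real (Suc j))
          = real (N choose Suc j) / real N ^ Suc j) sequentially"
    using eventually_ge_at_top[of "Suc j"]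
  proof eventually_elim
    case (elim N)
    have "Suc j * (N choose Suc j) = (N - j) * (N choose j)"
      using binomial_absorb_comp[of N j] binomial_absorption[of j N]
      by (metis binomial_absorb_comp binomial_absorption mult.commute diff_Suc_1 Suc_diff_1)
    then have "real (Suc j) * real (N choose Suc j) = (real N - real j) * real (N choose j)"
      using elim by (metis Suc_leD of_nat_diff of_nat_mult)
    then have "real (N choose Suc j) = (real N - real j) * real (N choose j) / real (Suc j)"
      by (simp add: field_simps)
    then show ?case by (simp only: power_Suc) (simp add: mult_ac)
  qed
  ultimately show ?case by (simp add: tendsto_cong mult_ac)
qed simp

text \<open>Stripping all other roots from the minimal recurrence leaves a sequence of exact order
  \<open>l\<^sup>N N\<^sup>m\<close>, which is a fixed linear combination of shifts of \<open>a\<close>.\<close>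

lemma recurrence_lower_bound:
  assumes "\<And>n. shift_poly p a n = 0" "p \<noteq> 0"
    and min: "\<And>q. q \<noteq> 0 \<Longrightarrow> Polynomial.degree q < Polynomial.degree p \<Longrightarrow> \<exists>n. shift_poly q a n \<noteq> 0"
    and l: "l \<noteq> 0" "Polynomial.order l p = Suc m"
  shows "\<exists>q. \<exists>c>0. eventually (\<lambda>N. c * norm l ^ N * real N ^ m \<le> norm (shift_poly q a N)) sequentially"
proof -
  obtain q where q: "p = [:-l, 1:] ^ Suc m * q"
    using order_decomp[OF assms(2), of l] l by auto
  define h where "h = shift_poly q a"
  have h0: "shift_poly ([:-l, 1:] ^ Suc m) h n = 0" for n
    using assms(1)[of n] unfolding q h_def by (simp only: shift_poly_mult)
  define H where "H = (\<lambda>j. shift_poly ([:-l, 1:] ^ j) h 0)"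
  \<comment> \<open>\<open>H m\<close> is the leading coefficient of the binomial expansion; were it
    zero, a polynomial of degree one less than \<open>p\<close> would annihilate
    \<open>a\<close>.\<close>
  have "H m \<noteq> 0"
  proof
    assume Hm: "H m = 0"
    \<comment> \<open>After applying the \<open>m\<close>-th power the sequence is geometric with
      ratio \<open>l\<close>, so its zero at index 0 makes it vanish identically.\<close>
    have step: "shift_poly ([:-l, 1:] ^ m) h (Suc n) = l * shift_poly ([:-l, 1:] ^ m) h n" for n
      using h0[of n] by (simp only: power_Suc shift_poly_mult) (simp add: shift_poly_pCons)
    have zero: "shift_poly ([:-l, 1:] ^ m) h n = 0" for n
      by (induction n) (use Hm step in \<open>auto simp: H_def\<close>)
    have q0: "q \<noteq> 0" using assms(2) q by auto
    have "Polynomial.degree p = Suc m + Polynomial.degree q"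
      unfolding q using q0 by (simp add: degree_mult_eq degree_power_eq del: power_Suc)
    moreover have "Polynomial.degree ([:-l, 1:] ^ m * q) = m + Polynomial.degree q"
      using q0 by (simp add: degree_mult_eq degree_power_eq)
    ultimately obtain n where "shift_poly ([:-l, 1:] ^ m * q) a n \<noteq> 0"
      using min[of "[:-l, 1:] ^ m * q"] q0 by auto
    then show False using zero[of n] by (simp add: shift_poly_mult h_def)
  qed
  \<comment> \<open>The limit of \<open>h N / (l ^ N * N ^ m)\<close>: only the term
    \<open>j = m\<close> survives, with \<open>N choose m\<close> asymptotic to
    \<open>N ^ m / fact m\<close>.\<close>
  define L where "L = H m / (l ^ m * fact m)"
  have "(\<lambda>N. \<Sum>j<Suc m. of_real (real (N choose j) / real N ^ m) * (H j / l ^ j))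
          \<longlonglongrightarrow> (\<Sum>j<Suc m. of_real (if j = m then 1 / fact m else 0) * (H j / l ^ j))"
  proof (intro tendsto_sum tendsto_mult tendsto_const tendsto_of_real)
    fix j assume j: "j \<in> {..<Suc m}"
    show "(\<lambda>N. real (N choose j) / real N ^ m) \<longlonglongrightarrow> (if j = m then 1 / fact m else 0)"
    proof (cases "j = m")
      case False
      then have jm: "j < m" using j by auto
      have "(\<lambda>N. 1 / real N ^ (m - j)) \<longlonglongrightarrow> 0"
        using jm by real_asymp
      then have "(\<lambda>N. real (N choose j) / real N ^ j * (1 / real N ^ (m - j))) \<longlonglongrightarrow> 1 / fact j * 0"
        by (intro tendsto_mult binomial_over_power_tendsto)
      also have "(\<lambda>N. real (N choose j) / real N ^ j * (1 / real N ^ (m - j))) = (\<lambda>N. real (N choose j) / real N ^ m)"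
        using jm by (simp flip: power_add)
      finally show ?thesis using False by simp
    qed (use binomial_over_power_tendsto[of m] in simp)
  qed
  moreover have "(\<Sum>j<Suc m. of_real (if j = m then 1 / fact m else 0) * (H j / l ^ j)) = L"
    by (simp add: L_def field_simps)
  ultimately have "(\<lambda>N. \<Sum>j<Suc m. of_real (real (N choose j) / real N ^ m) * (H j / l ^ j)) \<longlonglongrightarrow> L"
    by simp
  also have "?this \<longleftrightarrow> (\<lambda>N. h N / (l ^ N * of_nat N ^ m)) \<longlonglongrightarrow> L"
  proof (intro tendsto_cong)
    show "\<forall>\<^sub>F N in sequentially. (\<Sum>j<Suc m. of_real (real (N choose j) / real N ^ m) * (H j / l ^ j)) =
      h N / (l ^ N * of_nat N ^ m)"
      using eventually_gt_at_top[of m]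
    proof eventually_elim
      case (elim N)
      have "h N = (\<Sum>j<Suc m. of_nat (N choose j) * l ^ (N - j) * H j)"
        using shift_poly_binomial[OF h0, of N] by (simp add: H_def)
      also have "\<dots> / (l ^ N * of_nat N ^ m) = (\<Sum>j<Suc m. of_real (real (N choose j) / real N ^ m) * (H j / l ^ j))"
        unfolding sum_divide_distrib
        by (intro sum.cong refl) (use elim l in \<open>auto simp: field_simps power_diff\<close>)
      finally show ?case by simp
    qed
  qed
  finally have lim: "(\<lambda>N. norm (h N / (l ^ N * of_nat N ^ m))) \<longlonglongrightarrow> norm L"
    by (intro tendsto_norm)
  have "norm L > 0" using \<open>H m \<noteq> 0\<close> l by (simp add: L_def)
  then have "eventually (\<lambda>N. norm (h N / (l ^ N * of_nat N ^ m)) > norm L / 2) sequentially"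
    by (intro order_tendstoD[OF lim]) auto
  then have "eventually (\<lambda>N. norm L / 2 * norm l ^ N * real N ^ m \<le> norm (h N)) sequentially"
    using eventually_gt_at_top[of 0]
  proof eventually_elim
    case (elim N)
    then have "norm L / 2 < norm (h N) / (norm l ^ N * real N ^ m)"
      by (simp add: norm_divide norm_mult norm_power)
    then show ?case using elim l by (simp add: field_simps)
  qed
  then show ?thesis unfolding h_def using \<open>norm L > 0\<close> by (intro exI[of _ q] exI[of _ "norm L / 2"]) auto
qed

text \<open>Roots of largest modulus may oscillate against each other, so only a combination of
  shifts of \<open>a\<close> is bounded below directly. Since \<open>a\<close> is monotone and
  nonnegative, that combination is at most a constant times \<open>a (N + D)\<close>, which
  transfers the bound to \<open>a\<close> itself.\<close>

lemma monotone_recurrence_growth: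
  fixes a :: "nat \<Rightarrow> real"
  assumes mono: "mono a" and lim: "filterlim a at_top sequentially"
    and nonneg: "\<And>n. a n \<ge> 0"
    and "p0 \<noteq> 0" "\<And>n. shift_poly p0 (\<lambda>n. of_real (a n)) n = 0"
  shows "\<exists>\<alpha> m c1 c2. \<alpha> \<ge> 1 \<and> 0 < c1 \<and> 0 < c2 \<and>
    (\<forall>\<^sub>F N in sequentially. c1 * (\<alpha> ^ N * real N ^ m) \<le> a N \<and> a N \<le> c2 * (\<alpha> ^ N * real N ^ m))"
proof -
  define ann where "ann = (\<lambda>p. p \<noteq> 0 \<and> (\<forall>n. shift_poly p (\<lambda>n. of_real (a n)) n = 0))"
  \<comment> \<open>Minimal degree ensures that every root, with its full multiplicity, really
    occurs in \<open>a\<close>.\<close>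
  define p where "p = arg_min Polynomial.degree ann"
  have "ann p0" using assms by (simp add: ann_def)
  then have p: "ann p" unfolding p_def by (rule arg_min_natI)
  have min: "\<exists>n. shift_poly q (\<lambda>n. of_real (a n)) n \<noteq> 0"
    if "q \<noteq> 0" "Polynomial.degree q < Polynomial.degree p" for q
  proof (rule ccontr)
    assume "\<not> ?thesis"
    then have "ann q" using that by (auto simp: ann_def)
    then have "Polynomial.degree p \<le> Polynomial.degree q" unfolding p_def by (rule arg_min_nat_le)
    then show False using that by simp
  qed
  have p0: "p \<noteq> 0" "\<And>n. shift_poly p (\<lambda>n. of_real (a n)) n = 0" using p by (auto simp: ann_def)
  define R where "R = {l. poly p l = 0}"
  have finR: "finite R" unfolding R_def using p0 by (intro poly_roots_finite)
  \<comment> \<open>Otherwise the upper bound would make \<open>a\<close> decay, against its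
    divergence.\<close>
  have "\<exists>l\<in>R. norm l \<ge> 1"
  proof (rule ccontr)
    assume "\<not> ?thesis"
    then have lt: "\<And>l. l \<in> R \<Longrightarrow> norm l < 1" by force
    \<comment> \<open>The entry \<open>1/2\<close> covers an empty set of roots and keeps
      \<open>\<gamma>\<close> positive.\<close>
    define \<beta> where "\<beta> = Max (insert (1/2) (norm ` R))"
    have \<beta>: "\<beta> < 1" "\<beta> \<ge> 1/2" "\<And>l. l \<in> R \<Longrightarrow> norm l \<le> \<beta>"
    proof -
      show "\<beta> < 1" unfolding \<beta>_def using finR lt by (subst Max_less_iff) auto
      show "\<beta> \<ge> 1/2" unfolding \<beta>_def using finR by (intro Max_ge) auto
      show "norm l \<le> \<beta>" if "l \<in> R" for l unfolding \<beta>_def using finR that by (intro Max_ge) auto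
    qed
    define \<gamma> where "\<gamma> = (\<beta> + 1) / 2"
    have \<gamma>: "0 < \<gamma>" "\<gamma> < 1" "\<And>l. l \<in> R \<Longrightarrow> norm l < \<gamma>" unfolding \<gamma>_def using \<beta> by force+
    have "\<exists>C. \<forall>N. norm (complex_of_real (a N)) \<le> C * (\<gamma> ^ N * real (N + 1) ^ 0)"
      by (rule recurrence_upper_bound[OF p0]) (use \<gamma> in \<open>auto simp: R_def\<close>)
    then obtain C where C: "\<And>N. a N \<le> C * \<gamma> ^ N" using nonneg by auto
    have "(\<lambda>N. C * \<gamma> ^ N) \<longlonglongrightarrow> C * 0"
      using \<gamma> by (intro tendsto_mult tendsto_const LIMSEQ_power_zero) auto
    then have "eventually (\<lambda>N. C * \<gamma> ^ N < 1) sequentially" by (intro order_tendstoD) auto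
    moreover have "eventually (\<lambda>N. a N \<ge> 1) sequentially"
      using lim by (auto simp: filterlim_at_top)
    ultimately have "eventually (\<lambda>N. False) sequentially"
    proof eventually_elim
      case (elim N)
      then show ?case using C[of N] by linarith
    qed
    then show False by simp
  qed
  then have R: "R \<noteq> {}" by auto
  define \<alpha> where "\<alpha> = Max (norm ` R)"
  have \<alpha>1: "\<alpha> \<ge> 1" using \<open>\<exists>l\<in>R. norm l \<ge> 1\<close> finR unfolding \<alpha>_def
    by (meson Max_ge finite_imageI imageI order_trans)
  have \<alpha>_max: "norm l \<le> \<alpha>" if "l \<in> R" for l using that finR by (simp add: \<alpha>_def)
  define R' where "R' = {l\<in>R. norm l = \<alpha>}"
  have R': "finite R'" "R' \<noteq> {}"
  proof -
    have "\<alpha> \<in> norm ` R" unfolding \<alpha>_def using finR R by (intro Max_in) auto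
    then show "R' \<noteq> {}" by (auto simp: R'_def)
  qed (use finR in \<open>simp add: R'_def\<close>)
  \<comment> \<open>Among the roots of maximal modulus the largest multiplicity fixes the power
    \<open>m\<close> of \<open>N\<close>.\<close>
  define M where "M = Max ((\<lambda>l. Polynomial.order l p) ` R')"
  have "M \<in> (\<lambda>l. Polynomial.order l p) ` R'" unfolding M_def using R' by (intro Max_in) auto
  then obtain l where l: "l \<in> R'" "Polynomial.order l p = M" by auto
  have "M > 0" using l p0(1) by (auto simp: R'_def R_def order_gt_0_iff)
  then obtain m where m: "M = Suc m" by (cases M) auto
  have "\<exists>C. \<forall>N. norm (complex_of_real (a N)) \<le> C * (\<alpha> ^ N * real (N + 1) ^ m)"
  proof (rule recurrence_upper_bound[OF p0])
    show "norm l < \<alpha> \<or> norm l = \<alpha> \<and> Polynomial.order l p \<le> Suc m" if "poly p l = 0" for l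
    proof (cases "norm l = \<alpha>")
      case True
      then have "l \<in> R'" using that by (simp add: R'_def R_def)
      then have "Polynomial.order l p \<le> M" unfolding M_def using R' by simp
      then show ?thesis using True m by simp
    next
      case False
      then show ?thesis using \<alpha>_max[of l] that by (simp add: R_def)
    qed
  qed (use \<alpha>1 in simp)
  then obtain C where C: "\<And>N. a N \<le> C * (\<alpha> ^ N * real (N + 1) ^ m)" using nonneg by auto
  define c2 where "c2 = max 1 C * 2 ^ m"
  have upper: "a N \<le> c2 * (\<alpha> ^ N * real N ^ m)" if "N \<ge> 1" for N
  proof -
    have "a N \<le> C * (\<alpha> ^ N * real (N + 1) ^ m)" by (rule C)
    also have "\<dots> \<le> max 1 C * (\<alpha> ^ N * (2 * real N) ^ m)"
      using \<alpha>1 that by (intro mult_mono power_mono) auto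
    finally show ?thesis by (simp add: c2_def power_mult_distrib mult_ac)
  qed
  have "norm l = \<alpha>" using l by (simp add: R'_def)
  then have "l \<noteq> 0" using \<alpha>1 by auto
  then obtain q c where c: "c > 0"
    and ev: "eventually (\<lambda>N. c * norm l ^ N * real N ^ m \<le> norm (shift_poly q (\<lambda>n. of_real (a n)) N)) sequentially"
    using recurrence_lower_bound[OF p0(2,1) min, of l m] l m by auto
  define D where "D = Polynomial.degree q"
  define B where "B = 1 + (\<Sum>i\<le>D. norm (poly.coeff q i))"
  have "B > 0" unfolding B_def by (intro add_pos_nonneg sum_nonneg) auto
  have shift_le: "norm (shift_poly q (\<lambda>n. of_real (a n)) N) \<le> B * a (N + D)" for N
  proof -
    have "norm (shift_poly q (\<lambda>n. of_real (a n)) N) \<le> (\<Sum>i\<le>D. norm (poly.coeff q i * of_real (a (N + i))))"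
      unfolding shift_poly_def D_def by (rule norm_sum)
    also have "\<dots> = (\<Sum>i\<le>D. norm (poly.coeff q i) * a (N + i))"
      using nonneg by (simp add: norm_mult)
    also have "\<dots> \<le> (\<Sum>i\<le>D. norm (poly.coeff q i) * a (N + D))"
      by (intro sum_mono mult_left_mono monoD[OF mono]) auto
    also have "\<dots> \<le> B * a (N + D)"
      unfolding B_def distrib_right sum_distrib_right using nonneg by simp
    finally show ?thesis .
  qed
  obtain N0 where N0: "\<And>N. N \<ge> N0 \<Longrightarrow> c * \<alpha> ^ N * real N ^ m \<le> B * a (N + D)"
  proof -
    obtain N0 where "\<And>N. N \<ge> N0 \<Longrightarrow> c * \<alpha> ^ N * real N ^ m \<le> norm (shift_poly q (\<lambda>n. of_real (a n)) N)"
      using ev unfolding eventually_sequentially \<open>norm l = \<alpha>\<close> by blast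
    then show thesis using shift_le by (intro that[of N0]) (rule order_trans)
  qed
  \<comment> \<open>Passing from \<open>N\<close> to \<open>N - D\<close> costs
    \<open>\<alpha> ^ D\<close>, and \<open>N - D >= N / 2\<close> costs \<open>2 ^ m\<close>; hence
    the threshold \<open>N0 + 2 * D\<close>.\<close>
  define c1 where "c1 = c / (B * \<alpha> ^ D * 2 ^ m)"
  have c1: "c1 > 0" using c \<open>B > 0\<close> \<alpha>1 by (simp add: c1_def)
  have lower: "c1 * (\<alpha> ^ N * real N ^ m) \<le> a N" if N: "N \<ge> N0 + 2 * D" for N
  proof -
    have "(real N / 2) ^ m \<le> real (N - D) ^ m" using N by (intro power_mono) auto
    then have "c * \<alpha> ^ (N - D) * (real N / 2) ^ m \<le> c * \<alpha> ^ (N - D) * real (N - D) ^ m"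
      using c \<alpha>1 by (intro mult_left_mono) auto
    also have "\<dots> \<le> B * a N" using N0[of "N - D"] N by simp
    finally have le: "c * (\<alpha> ^ N / \<alpha> ^ D) * (real N ^ m / 2 ^ m) \<le> B * a N"
      using N \<alpha>1 by (simp add: power_diff power_divide)
    have "c1 * (\<alpha> ^ N * real N ^ m) = c * (\<alpha> ^ N / \<alpha> ^ D) * (real N ^ m / 2 ^ m) / B"
      by (simp add: c1_def mult_ac)
    also have "\<dots> \<le> B * a N / B" using le \<open>B > 0\<close> by (intro divide_right_mono) auto
    also have "\<dots> = a N" using \<open>B > 0\<close> by simp
    finally show ?thesis .
  qed
  have "c2 > 0" by (auto simp: c2_def)
  moreover have "\<forall>\<^sub>F N in sequentially. c1 * (\<alpha> ^ N * real N ^ m) \<le> a N \<and> a N \<le> c2 * (\<alpha> ^ N * real N ^ m)"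
    using eventually_ge_at_top[of "N0 + 2 * D + 1"] by eventually_elim (use lower upper in auto)
  ultimately show ?thesis using \<alpha>1 c1 by blast
qed

subsection \<open>Growth of regular sequences\<close>

text \<open>The case \<open>n = 0\<close> is excluded because 0 has the one-digit expansion
  \<open>[0]\<close>, so the right-hand side would acquire a leading zero. Recursions in the digits
  therefore start from \<open>n = 1\<close>.\<close>

lemma base_digits_mult_add:
  assumes "k \<ge> 2" "r < k" "n \<ge> 1"
  shows "base_digits k (k * n + r) = r # base_digits k n"
proof -
  have "k \<le> k * n" using assms by simp
  then have "\<not> (k < 2 \<or> k * n + r < k)" using assms(1) by linarith
  moreover have "(k * n + r) mod k = r" "(k * n + r) div k = n" using assms by auto
  ultimately show ?thesis by (subst base_digits.simps) simp
qed

lemma base_digits_lt: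
  assumes "k \<ge> 2"
  shows "\<forall>i\<in>set (base_digits k n). i < k"
proof (induction n rule: less_induct)
  case (less n)
  show ?case
  proof (cases "n < k")
    case True
    then show ?thesis by (subst base_digits.simps) simp
  next
    case False
    then have "n div k < n" using assms by (intro div_less_dividend) auto
    from less[OF this] show ?thesis using False assms by (subst base_digits.simps) auto
  qed
qed

text \<open>The auxiliary sequences are the coordinates of the matrix product applied to
  \<open>v\<close>. As the least significant digit comes first, a new last digit \<open>r\<close>
  multiplies by \<open>A r\<close> on the left.\<close>

lemma k_regular_linear_system:
  assumes "k_regular k f" "k \<ge> 2"
  obtains d and A :: "nat \<Rightarrow> nat \<Rightarrow> nat \<Rightarrow> int" and \<phi> :: "nat \<Rightarrow> nat \<Rightarrow> int" and w where
    "\<And>n. f n = (\<Sum>i<d. w i * \<phi> i n)"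
    "\<And>n r i. n \<ge> 1 \<Longrightarrow> r < k \<Longrightarrow> i < d \<Longrightarrow> \<phi> i (k * n + r) = (\<Sum>j<d. A r i j * \<phi> j n)"
proof -
  obtain d A v w where A: "\<And>i. i < k \<Longrightarrow> A i \<in> carrier_mat d d" and v: "v \<in> carrier_vec d"
    and w: "w \<in> carrier_vec d"
    and f: "\<And>n. f n = scalar_prod w (foldr (\<lambda>i M. A i * M) (base_digits k n) (1\<^sub>m d) *\<^sub>v v)"
    using assms(1) unfolding k_regular_def by blast
  define M where "M = (\<lambda>n. foldr (\<lambda>i M. A i * M) (base_digits k n) (1\<^sub>m d))"
  have carr: "foldr (\<lambda>i M. A i * M) xs (1\<^sub>m d) \<in> carrier_mat d d" if "\<forall>i\<in>set xs. i < k" for xs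
    using that by (induction xs) (auto intro!: mult_carrier_mat A)
  have M: "M n \<in> carrier_mat d d" for n
    unfolding M_def by (intro carr base_digits_lt assms)
  define \<phi> where "\<phi> = (\<lambda>i n. (M n *\<^sub>v v) $ i)"
  have dimMv: "dim_vec (M n *\<^sub>v v) = d" for n using M[of n] by auto
  show thesis
  proof (rule that)
    show "f n = (\<Sum>i<d. w $ i * \<phi> i n)" for n
    proof -
      have "f n = w \<bullet> (M n *\<^sub>v v)" by (simp only: f M_def)
      then show ?thesis unfolding scalar_prod_def dimMv \<phi>_def by (simp add: atLeast0LessThan)
    qed
    show "\<phi> i (k * n + r) = (\<Sum>j<d. A r $$ (i, j) * \<phi> j n)" if "n \<ge> 1" "r < k" "i < d" for n r i
    proof -
      have "M (k * n + r) = A r * M n"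
        unfolding M_def using base_digits_mult_add[OF assms(2) that(2,1)] by simp
      then have "M (k * n + r) *\<^sub>v v = A r *\<^sub>v (M n *\<^sub>v v)"
        using A[OF that(2)] M[of n] v by (simp add: assoc_mult_mat_vec)
      then have "\<phi> i (k * n + r) = row (A r) i \<bullet> (M n *\<^sub>v v)"
        unfolding \<phi>_def using A[OF that(2)] that(3) by simp
      also have "\<dots> = (\<Sum>j<d. A r $$ (i, j) * \<phi> j n)"
        unfolding scalar_prod_def dimMv \<phi>_def using A[OF that(2)] that(3) by (auto simp: atLeast0LessThan intro!: sum.cong)
      finally show ?thesis .
    qed
  qed
qed

lemma sum_digit_block:
  fixes g :: "nat \<Rightarrow> 'a::comm_monoid_add"
  shows "(\<Sum>n\<in>{k * a..<k * b}. g n) = (\<Sum>n\<in>{a..<b}. \<Sum>r<k. g (k * n + r))"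
proof (induction b)
  case (Suc b)
  show ?case
  proof (cases "a \<le> b")
    case True
    have "(\<Sum>n\<in>{k * a..<k * Suc b}. g n) = (\<Sum>n\<in>{k * a..<k * b}. g n) + (\<Sum>n\<in>{k * b..<k * b + k}. g n)"
      using sum.atLeastLessThan_concat[of "k * a" "k * b" "k * b + k" g] mult_le_mono2[OF True, of k]
      by (simp add: add.commute)
    also have "(\<Sum>n\<in>{k * b..<k * b + k}. g n) = (\<Sum>r<k. g (k * b + r))"
      using sum.shift_bounds_nat_ivl[of g 0 "k * b" k] by (simp add: atLeast0LessThan add_ac)
    finally show ?thesis using Suc True by simp
  next
    case False
    then have "k * Suc b \<le> k * a" by (intro mult_le_mono2) auto
    then have "{k * a..<k * Suc b} = {}" by simp
    then show ?thesis using False by simp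
  qed
qed simp

text \<open>Summing over the last digit gives \<open>T (s + 1) = B T s\<close> for the vector of
  block sums, with \<open>B\<close> the sum of the digit matrices. The \<open>d + 1\<close> vectors
  \<open>T 0, ..., T d\<close> are dependent, and applying \<open>B\<close> repeatedly propagates
  the dependence; this takes the place of Cayley-Hamilton.\<close>

lemma k_regular_block_recurrence:
  assumes "k_regular k f" "k \<ge> 2"
  shows "\<exists>p. p \<noteq> 0 \<and> (\<forall>N. shift_poly p (\<lambda>s. of_int (\<Sum>n\<in>{k^s..<k^Suc s}. f n)) N = 0)"
proof -
  obtain d and A :: "nat \<Rightarrow> nat \<Rightarrow> nat \<Rightarrow> int" and \<phi> w where
    f: "\<And>n. f n = (\<Sum>i<d. w i * \<phi> i n)" and
    \<phi>: "\<And>n r i. n \<ge> 1 \<Longrightarrow> r < k \<Longrightarrow> i < d \<Longrightarrow> \<phi> i (k * n + r) = (\<Sum>j<d. A r i j * \<phi> j n)"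
    by (rule k_regular_linear_system[OF assms]) (rule that)
  define T where "T = (\<lambda>i s. \<Sum>n\<in>{k^s..<k^Suc s}. \<phi> i n)"
  define B where "B = (\<lambda>i j. \<Sum>r<k. A r i j)"
  have T_Suc: "T i (Suc s) = (\<Sum>j<d. B i j * T j s)" if "i < d" for i s
  proof -
    have "T i (Suc s) = (\<Sum>n\<in>{k^s..<k^Suc s}. \<Sum>r<k. \<phi> i (k * n + r))"
      unfolding T_def by (subst sum_digit_block[symmetric]) simp
    also have "\<dots> = (\<Sum>n\<in>{k^s..<k^Suc s}. \<Sum>r<k. \<Sum>j<d. A r i j * \<phi> j n)"
    proof (intro sum.cong refl \<phi> that)
      fix n assume "n \<in> {k^s..<k^Suc s}"
      moreover have "k ^ s \<ge> 1" using assms by simp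
      ultimately show "n \<ge> 1" by (meson atLeastLessThan_iff order_trans)
    qed auto
    also have "\<dots> = (\<Sum>n\<in>{k^s..<k^Suc s}. \<Sum>j<d. B i j * \<phi> j n)"
      unfolding B_def sum_distrib_right by (intro sum.cong refl sum.swap)
    also have "\<dots> = (\<Sum>j<d. B i j * T j s)"
      unfolding T_def sum_distrib_left by (rule sum.swap)
    finally show ?thesis .
  qed
  have "\<exists>c. (\<forall>u. c u \<in> (UNIV::complex set)) \<and> (\<exists>u\<in>{..d}. c u \<noteq> 0) \<and>
      (\<forall>e\<in>{..<d}. (\<Sum>u\<in>{..d}. of_int (T e u) * c u) = 0)"
    by (rule homogeneous_system_nontrivial_solution[OF is_subfield_UNIV]) auto
  then obtain c :: "nat \<Rightarrow> complex" where
    c: "\<exists>u\<le>d. c u \<noteq> 0" "\<And>i. i < d \<Longrightarrow> (\<Sum>u\<le>d. of_int (T i u) * c u) = 0" by auto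
  have rec: "(\<Sum>u\<le>d. of_int (T i (u + N)) * c u) = 0" if "i < d" for i N
    using that
  proof (induction N arbitrary: i)
    case (Suc N)
    have "(\<Sum>u\<le>d. of_int (T i (u + Suc N)) * c u) = (\<Sum>u\<le>d. \<Sum>j<d. of_int (B i j) * (of_int (T j (u + N)) * c u))"
      using Suc.prems by (simp add: T_Suc sum_distrib_left sum_distrib_right mult_ac)
    also have "\<dots> = (\<Sum>j<d. of_int (B i j) * (\<Sum>u\<le>d. of_int (T j (u + N)) * c u))"
      unfolding sum_distrib_left by (rule sum.swap)
    also have "\<dots> = 0" using Suc.IH by simp
    finally show ?case .
  qed (use c in simp)
  define p where "p = (\<Sum>u\<le>d. Polynomial.monom (c u) u)"
  have "poly.coeff p u = c u" if "u \<le> d" for u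
    using that by (simp add: p_def coeff_sum)
  then have "p \<noteq> 0" using c(1) by auto
  moreover have "shift_poly p (\<lambda>s. of_int (\<Sum>n\<in>{k^s..<k^Suc s}. f n)) N = 0" for N
  proof -
    have b: "(\<Sum>n\<in>{k^s..<k^Suc s}. f n) = (\<Sum>i<d. w i * T i s)" for s
      unfolding f T_def sum_distrib_left by (rule sum.swap)
    have "shift_poly p (\<lambda>s. of_int (\<Sum>n\<in>{k^s..<k^Suc s}. f n)) N = (\<Sum>u\<le>d. c u * of_int (\<Sum>i<d. w i * T i (N + u)))"
      unfolding b p_def by (simp add: shift_poly_sum shift_poly_monom)
    also have "\<dots> = (\<Sum>u\<le>d. \<Sum>i<d. of_int (w i) * (of_int (T i (u + N)) * c u))"
      by (simp add: sum_distrib_left mult_ac add_ac)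
    also have "\<dots> = (\<Sum>i<d. of_int (w i) * (\<Sum>u\<le>d. of_int (T i (u + N)) * c u))"
      unfolding sum_distrib_left by (rule sum.swap)
    also have "\<dots> = 0" using rec by simp
    finally show ?thesis .
  qed
  ultimately show ?thesis by blast
qed

text \<open>Integrality matters: each nonzero term is at least 1, and there are infinitely
  many.\<close>

lemma partial_sums_at_top:
  fixes f :: "nat \<Rightarrow> int"
  assumes "\<And>n. f n \<ge> 0" "\<not> (\<forall>\<^sub>F n in sequentially. f n = 0)"
  shows "filterlim (\<lambda>N. \<Sum>n\<le>N. real_of_int (f n)) at_top sequentially"
  unfolding filterlim_at_top
proof
  fix Z :: real
  have "infinite {n. f n \<noteq> 0}"
    using assms(2) by (simp add: eventually_cofinite flip: cofinite_eq_sequentially)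
  from infinite_arbitrarily_large[OF this, of "nat (ceiling Z)"]
  obtain B where B: "finite B" "card B = nat (ceiling Z)" "B \<subseteq> {n. f n \<noteq> 0}"
    by auto
  show "\<forall>\<^sub>F N in sequentially. Z \<le> (\<Sum>n\<le>N. real_of_int (f n))"
    using eventually_ge_at_top[of "Max (insert 0 B)"]
  proof eventually_elim
    case (elim N)
    have "B \<subseteq> {..N}" using elim B(1) by auto
    have "Z \<le> real (card B)" unfolding B(2) by linarith
    also have "\<dots> = (\<Sum>n\<in>B. 1)" by simp
    also have "\<dots> \<le> (\<Sum>n\<in>B. real_of_int (f n))"
    proof (intro sum_mono)
      fix n assume "n \<in> B"
      then have "f n \<ge> 1" using B(3) assms(1)[of n] by fastforce
      then show "1 \<le> real_of_int (f n)" by simp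
    qed
    also have "\<dots> \<le> (\<Sum>n\<le>N. real_of_int (f n))"
      using \<open>B \<subseteq> {..N}\<close> assms(1) by (intro sum_mono2) auto
    finally show ?case .
  qed
qed

text \<open>The sums over \<open>n < k^j\<close> have the block sums as first differences, so one
  extra factor \<open>[:-1, 1:]\<close> in the recurrence annihilates them.\<close>

lemma k_regular_power_sum_growth:
  assumes "k_regular k f" "k \<ge> 2" "\<And>n. f n \<ge> 0" "\<not> (\<forall>\<^sub>F n in sequentially. f n = 0)"
  shows "\<exists>\<alpha> m c1 c2. \<alpha> \<ge> 1 \<and> 0 < c1 \<and> 0 < c2 \<and>
    (\<forall>\<^sub>F j in sequentially. c1 * (\<alpha> ^ j * real j ^ m) \<le> (\<Sum>n<k^j. real_of_int (f n)) \<and>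
       (\<Sum>n<k^j. real_of_int (f n)) \<le> c2 * (\<alpha> ^ j * real j ^ m))"
proof -
  define a where "a = (\<lambda>j. \<Sum>n<k^j. real_of_int (f n))"
  have mono: "mono a"
    unfolding a_def using assms by (intro monoI sum_mono2) (auto intro: less_le_trans power_increasing)
  have nonneg: "a j \<ge> 0" for j unfolding a_def using assms by (intro sum_nonneg) auto
  have lim: "filterlim a at_top sequentially"
  proof (rule filterlim_at_top_mono)
    have "filterlim (\<lambda>j. j - 1) at_top (sequentially :: nat filter)" by real_asymp
    then show "filterlim (\<lambda>j. \<Sum>n\<le>j - 1. real_of_int (f n)) at_top sequentially"
      by (rule filterlim_compose[OF partial_sums_at_top[OF assms(3,4)]])
    show "\<forall>\<^sub>F j in sequentially. (\<Sum>n\<le>j - 1. real_of_int (f n)) \<le> a j"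
      using eventually_ge_at_top[of 1]
    proof eventually_elim
      case (elim j)
      have "j < k ^ j" using assms(2) by (intro power_gt_expt) auto
      then show ?case unfolding a_def using assms(3) elim by (intro sum_mono2) auto
    qed
  qed
  obtain p where p: "p \<noteq> 0" "\<And>N. shift_poly p (\<lambda>s. of_int (\<Sum>n\<in>{k^s..<k^Suc s}. f n)) N = 0"
    using k_regular_block_recurrence[OF assms(1,2)] by blast
  have diff: "shift_poly [:-1, 1:] (\<lambda>j. complex_of_real (a j)) s = of_int (\<Sum>n\<in>{k^s..<k^Suc s}. f n)" for s
  proof -
    have "k ^ s \<le> k ^ Suc s" using assms(2) by (intro power_increasing) auto
    then have "a (Suc s) = a s + real_of_int (\<Sum>n\<in>{k^s..<k^Suc s}. f n)"
      unfolding a_def lessThan_atLeast0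
      using sum.atLeastLessThan_concat[of 0 "k ^ s" "k ^ Suc s" "\<lambda>n. real_of_int (f n)"] by simp
    then show ?thesis by (simp add: shift_poly_pCons)
  qed
  have "shift_poly (p * [:-1, 1:]) (\<lambda>j. complex_of_real (a j)) n = 0" for n
    using p(2)[of n] by (simp only: shift_poly_mult) (simp add: diff[abs_def])
  moreover have "p * [:-1, 1:] \<noteq> 0" using p(1) by (simp only: mult_eq_0_iff) simp
  ultimately show ?thesis
    using monotone_recurrence_growth[OF mono lim nonneg] unfolding a_def by blast
qed

text \<open>Interpolation between powers of \<open>k\<close>: if \<open>k^j <= N < k^(j+1)\<close>,
  then \<open>N powr \<beta>\<close> lies between \<open>\<alpha>^j\<close> and
  \<open>\<alpha>^(j+1)\<close> and \<open>ln N\<close> is comparable to \<open>j\<close>.\<close>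

lemma k_regular_has_growth_base:
  assumes "k_regular k f" "k \<ge> 2" "\<And>n. f n \<ge> 0" "\<not> (\<forall>\<^sub>F n in sequentially. f n = 0)"
  shows "\<exists>\<alpha>. has_growth_base k f \<alpha>"
proof -
  obtain \<alpha> m c1 c2 where \<alpha>: "\<alpha> \<ge> 1" and c: "0 < c1" "0 < c2" and
    ev: "\<forall>\<^sub>F j in sequentially. c1 * (\<alpha> ^ j * real j ^ m) \<le> (\<Sum>n<k^j. real_of_int (f n)) \<and>
       (\<Sum>n<k^j. real_of_int (f n)) \<le> c2 * (\<alpha> ^ j * real j ^ m)"
    using k_regular_power_sum_growth[OF assms] by blast
  obtain J where J: "\<And>j. j \<ge> J \<Longrightarrow> c1 * (\<alpha> ^ j * real j ^ m) \<le> (\<Sum>n<k^j. real_of_int (f n))"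
    "\<And>j. j \<ge> J \<Longrightarrow> (\<Sum>n<k^j. real_of_int (f n)) \<le> c2 * (\<alpha> ^ j * real j ^ m)"
    using ev unfolding eventually_sequentially by blast
  define \<beta> where "\<beta> = log (real k) \<alpha>"
  have k: "real k > 1" "ln (real k) > 0" using assms(2) by auto
  have \<beta>: "\<beta> \<ge> 0" using \<alpha> k by (simp add: \<beta>_def)
  have pow: "real (k ^ j) powr \<beta> = \<alpha> ^ j" for j
  proof -
    have "real (k ^ j) powr \<beta> = (real k powr \<beta>) ^ j"
      using k by (simp add: powr_powr mult.commute flip: powr_realpow)
    also have "real k powr \<beta> = \<alpha>" using k \<alpha> by (simp add: \<beta>_def)
    finally show ?thesis .
  qed
  \<comment> \<open>A factor \<open>\<alpha>\<close> pays for the gap between neighbouring powers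
    and a factor 2 for \<open>j + 1 <= 2 * j\<close>; the maximum in \<open>C2\<close> secures
    \<open>C1 <= C2\<close>.\<close>
  define C1 where "C1 = c1 / \<alpha> / (2 * ln (real k)) ^ m"
  define C2 where "C2 = max C1 (c2 * \<alpha> * (2 / ln (real k)) ^ m)"
  have "C1 > 0" using c \<alpha> k by (simp add: C1_def)
  have "\<forall>\<^sub>F N in sequentially. C1 * real N powr \<beta> * ln (real N) ^ m \<le> (\<Sum>n\<le>N. real_of_int (f n)) \<and>
           (\<Sum>n\<le>N. real_of_int (f n)) \<le> C2 * real N powr \<beta> * ln (real N) ^ m"
    using eventually_ge_at_top[of "k ^ (J + 1)"]
  proof eventually_elim
    case (elim N)
    have "N \<ge> 1" using elim assms(2) by (meson le_trans one_le_numeral one_le_power)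
    then obtain j where j: "k ^ j \<le> N" "N < k ^ (j + 1)"
      using ex_power_ivl1[of k N] assms(2) by auto
    \<comment> \<open>The threshold lies one power above \<open>J\<close>, which yields
      \<open>j > J\<close> and in particular \<open>j >= 1\<close>.\<close>
    have "k ^ (J + 1) < k ^ (j + 1)" using elim j(2) by linarith
    then have jJ: "J < j" using assms(2) by (simp add: power_less_imp_less_exp)
    let ?S = "\<Sum>n\<le>N. real_of_int (f n)"
    have "(\<Sum>n<k^j. real_of_int (f n)) \<le> ?S"
      using j(1) assms(3) by (intro sum_mono2) auto
    then have S1: "c1 * (\<alpha> ^ j * real j ^ m) \<le> ?S" using J(1)[of j] jJ by simp
    have "?S \<le> (\<Sum>n<k^(j+1). real_of_int (f n))"
      using j(2) assms(3) by (intro sum_mono2) auto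
    then have S2: "?S \<le> c2 * (\<alpha> ^ (j + 1) * real (j + 1) ^ m)" using J(2)[of "j + 1"] jJ by linarith
    have N1: "\<alpha> ^ j \<le> real N powr \<beta>" unfolding pow[symmetric] using j(1) \<beta> by (intro powr_mono2) auto
    have N2: "real N powr \<beta> \<le> \<alpha> ^ (j + 1)" unfolding pow[symmetric]
      using j(2) \<beta> by (intro powr_mono2) (auto simp del: power_Suc of_nat_power)
    have "ln (real (k ^ j)) \<le> ln (real N)" using j(1) assms(2) \<open>N \<ge> 1\<close> by (subst ln_le_cancel_iff) (auto simp del: of_nat_power)
    then have L1: "real j * ln (real k) \<le> ln (real N)" using k by (simp add: ln_realpow)
    have "ln (real N) \<le> ln (real (k ^ (j + 1)))"
      using j(2) assms(2) \<open>N \<ge> 1\<close> by (subst ln_le_cancel_iff) (auto simp del: power_Suc of_nat_power)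
    also have "\<dots> = (real j + 1) * ln (real k)" using k by (simp only: of_nat_power ln_realpow) simp
    finally have L2: "ln (real N) \<le> (real j + 1) * ln (real k)" .
    have L0: "ln (real N) \<ge> 0" using \<open>N \<ge> 1\<close> by simp
    have jr: "real j \<ge> 1" using jJ by simp
    have "C1 * real N powr \<beta> * ln (real N) ^ m \<le> C1 * \<alpha> ^ (j + 1) * (2 * ln (real k) * real j) ^ m"
    proof (intro mult_mono power_mono N2 L0)
      have "(real j + 1) * ln (real k) \<le> (2 * real j) * ln (real k)"
        using jr k by (intro mult_right_mono) auto
      then show "ln (real N) \<le> 2 * ln (real k) * real j" using L2 by (simp add: mult_ac)
    qed (use \<open>C1 > 0\<close> \<alpha> L0 in auto)
    also have "\<dots> = c1 * (\<alpha> ^ j * real j ^ m)"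
      using \<alpha> k by (simp add: C1_def power_mult_distrib)
    finally have lower: "C1 * real N powr \<beta> * ln (real N) ^ m \<le> ?S" using S1 by linarith
    have "?S \<le> c2 * (\<alpha> ^ (j + 1) * real (j + 1) ^ m)" by (rule S2)
    also have "\<dots> \<le> c2 * (\<alpha> * real N powr \<beta> * (2 / ln (real k) * ln (real N)) ^ m)"
    proof (intro mult_left_mono mult_mono power_mono)
      show "\<alpha> ^ (j + 1) \<le> \<alpha> * real N powr \<beta>" using N1 \<alpha> by simp
      have "real (j + 1) \<le> 2 * real j" using jr by simp
      also have "real j \<le> ln (real N) / ln (real k)" using L1 k by (simp add: field_simps)
      finally show "real (j + 1) \<le> 2 / ln (real k) * ln (real N)" by simp
    qed (use c \<alpha> in auto)
    also have "\<dots> = (c2 * \<alpha> * (2 / ln (real k)) ^ m) * real N powr \<beta> * ln (real N) ^ m"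
      by (simp add: power_mult_distrib power_divide mult_ac)
    also have "\<dots> \<le> C2 * real N powr \<beta> * ln (real N) ^ m"
      using L0 by (intro mult_right_mono) (auto simp: C2_def)
    finally show ?case using lower by blast
  qed
  moreover have "C1 \<le> C2" by (simp add: C2_def)
  ultimately show ?thesis
    unfolding has_growth_base_def \<beta>_def using \<open>C1 > 0\<close> \<alpha> by blast
qed

text \<open>After division by \<open>ln N\<close> the constants and the term
  \<open>m * ln (ln N)\<close> tend to 0. This gives uniqueness of the growth base as well as the
  input for the power series.\<close>

lemma has_growth_base_log_limit:
  assumes "has_growth_base k f \<alpha>"
  shows "(\<lambda>N. ln (\<Sum>n\<le>N. real_of_int (f n)) / ln (real N)) \<longlonglongrightarrow> log (real k) \<alpha>"
proof -
  define \<beta> where "\<beta> = log (real k) \<alpha>"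
  obtain m c1 c2 where c: "0 < c1" "c1 \<le> c2" and
    ev: "\<forall>\<^sub>F N in sequentially.
           c1 * real N powr \<beta> * ln (real N) ^ m \<le> (\<Sum>n\<le>N. real_of_int (f n)) \<and>
           (\<Sum>n\<le>N. real_of_int (f n)) \<le> c2 * real N powr \<beta> * ln (real N) ^ m"
    using assms unfolding has_growth_base_def \<beta>_def by blast
  define g where "g = (\<lambda>c N. (ln c + \<beta> * ln (real N) + real m * ln (ln (real N))) / ln (real N))"
  have g: "(\<lambda>N. g c N) \<longlonglongrightarrow> \<beta>" for c unfolding g_def by real_asymp
  have ln_eq: "ln (c * real N powr \<beta> * ln (real N) ^ m) = ln c + \<beta> * ln (real N) + real m * ln (ln (real N))"
    if "c > 0" "N \<ge> 2" for c N
    using that by (simp add: ln_mult ln_powr ln_realpow)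
  show ?thesis unfolding \<beta>_def[symmetric]
  proof (rule tendsto_sandwich[OF _ _ g g])
    show "\<forall>\<^sub>F N in sequentially. g c1 N \<le> ln (\<Sum>n\<le>N. real_of_int (f n)) / ln (real N)"
      using ev eventually_ge_at_top[of 2]
    proof eventually_elim
      case (elim N)
      have pos: "c1 * real N powr \<beta> * ln (real N) ^ m > 0" using c elim by simp
      then have "ln (c1 * real N powr \<beta> * ln (real N) ^ m) \<le> ln (\<Sum>n\<le>N. real_of_int (f n))"
        using elim by (intro ln_mono) auto
      then show ?case unfolding g_def using elim ln_eq[of c1 N] c by (intro divide_right_mono) auto
    qed
    show "\<forall>\<^sub>F N in sequentially. ln (\<Sum>n\<le>N. real_of_int (f n)) / ln (real N) \<le> g c2 N"
      using ev eventually_ge_at_top[of 2]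
    proof eventually_elim
      case (elim N)
      have pos: "c1 * real N powr \<beta> * ln (real N) ^ m > 0" using c elim by simp
      then have "ln (\<Sum>n\<le>N. real_of_int (f n)) \<le> ln (c2 * real N powr \<beta> * ln (real N) ^ m)"
        using elim by (intro ln_mono) linarith+
      then show ?case unfolding g_def using elim ln_eq[of c2 N] c by (intro divide_right_mono) auto
    qed
  qed
qed

text \<open>Justifies the definite description in \<open>growth_base\<close>: existence comes from
  the recurrence, uniqueness from the common limit and injectivity of the logarithm.\<close>

lemma has_growth_base_growth_base:
  assumes "k_regular k f" "k \<ge> 2" "\<And>n. f n \<ge> 0" "\<not> (\<forall>\<^sub>F n in sequentially. f n = 0)"
  shows "has_growth_base k f (growth_base k f)"
proof -
  have "\<exists>!\<alpha>. has_growth_base k f \<alpha>"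
  proof (rule ex_ex1I[OF k_regular_has_growth_base[OF assms]])
    fix \<alpha> \<beta> assume *: "has_growth_base k f \<alpha>" "has_growth_base k f \<beta>"
    then have "log (real k) \<alpha> = log (real k) \<beta>"
      using LIMSEQ_unique has_growth_base_log_limit by blast
    moreover have "\<alpha> \<ge> 1" "\<beta> \<ge> 1" using * by (auto simp: has_growth_base_def)
    ultimately show "\<alpha> = \<beta>" using assms(2) by (auto simp: log_def)
  qed
  then show ?thesis unfolding growth_base_def by (rule theI')
qed

subsection \<open>Behaviour of the power series near 1\<close>

text \<open>The function \<open>u powr b * exp (- u / 2)\<close> peaks at \<open>u = 2 * b\<close>;
  the inequality \<open>ln v <= v - 1\<close> at \<open>v = u / (2 * b)\<close> gives this constant
  once a factor \<open>exp (- b)\<close> is dropped.\<close>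

lemma powr_le_exp_half:
  fixes u b :: real
  assumes "u > 0" "b > 0"
  shows "u powr b \<le> exp (b * ln (2 * b)) * exp (u / 2)"
proof -
  have "ln u = ln (u / (2 * b)) + ln (2 * b)" using assms by (simp add: ln_div)
  also have "ln (u / (2 * b)) \<le> u / (2 * b) - 1" using assms by (intro ln_le_minus_one) auto
  finally have "ln u \<le> u / (2 * b) + ln (2 * b)" by simp
  then have "b * ln u \<le> b * (u / (2 * b) + ln (2 * b))" using assms by (intro mult_left_mono) auto
  also have "\<dots> = u / 2 + b * ln (2 * b)" using assms by (simp add: field_simps)
  finally have "exp (b * ln u) \<le> exp (u / 2 + b * ln (2 * b))" by simp
  then show ?thesis using assms by (simp add: powr_def exp_add mult_ac)
qed

text \<open>Summation by parts turns the series into \<open>1 - x\<close> times the sum of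
  \<open>S N * x ^ N\<close>. With \<open>t = 1 - x\<close> and \<open>u = t * (N + 1)\<close>, half
  of the decay \<open>exp (- u)\<close> absorbs \<open>u powr b\<close>, and the other half leaves a
  geometric series of size at most \<open>2 / t\<close>.\<close>

lemma abelian_upper_bound:
  fixes f :: "nat \<Rightarrow> real" and b C :: real
  defines "S \<equiv> \<lambda>N. \<Sum>n\<le>N. f n"
  assumes nonneg: "\<And>n. f n \<ge> 0" and b: "b > 0" and C: "C > 0"
    and S: "\<And>N. S N \<le> C * real (N + 1) powr b"
    and x: "0 < x" "x < 1"
  shows "summable (\<lambda>n. f n * x ^ n)"
    and "(suminf (\<lambda>n. f n * x ^ n)) \<le> (2 * C * exp 1 * exp (b * ln (2 * b))) * (1 - x) powr (-b)"
proof -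
  define t where "t = 1 - x"
  have t: "0 < t" "t < 1" using x by (auto simp: t_def)
  define K where "K = exp (b * ln (2 * b))"
  define y where "y = exp (- t / 2)"
  have y: "0 < y" "y < 1" using t by (auto simp: y_def)
  have S0: "S N \<ge> 0" for N unfolding S_def using nonneg by (intro sum_nonneg) auto
  define D where "D = C * exp 1 * K * t powr (-b)"
  have "K > 0" "D > 0" using C t by (auto simp: D_def K_def)
  have term_le: "S N * x ^ N \<le> D * y * y ^ N" for N
  proof -
    define u where "u = t * real (N + 1)"
    have u: "u > 0" using t by (simp add: u_def)
    have "x \<le> exp (- t)" using exp_ge_add_one_self[of "- t"] by (simp add: t_def)
    then have "x ^ N \<le> exp (- t) ^ N" using x by (intro power_mono) auto
    also have "\<dots> = exp (t - u)" by (simp add: u_def exp_of_nat_mult[symmetric] algebra_simps)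
    \<comment> \<open>\<open>t < 1\<close> replaces \<open>exp t\<close> by the constant
      \<open>exp 1\<close>.\<close>
    also have "\<dots> \<le> exp (1 - u)" using t by simp
    finally have xN: "x ^ N \<le> exp 1 * exp (- u)" by (simp flip: exp_add)
    have "real (N + 1) powr b = t powr (-b) * u powr b"
      using t by (simp add: u_def powr_mult powr_minus)
    also have "\<dots> \<le> t powr (-b) * (K * exp (u / 2))"
      unfolding K_def using powr_le_exp_half[OF u b] by (intro mult_left_mono) auto
    finally have Np: "real (N + 1) powr b \<le> t powr (-b) * (K * exp (u / 2))" .
    have "S N * x ^ N \<le> (C * (t powr (-b) * (K * exp (u / 2)))) * (exp 1 * exp (- u))"
      using Np xN C S0[of N] x \<open>K > 0\<close> by (intro mult_mono order_trans[OF S] mult_left_mono) auto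
    also have "\<dots> = D * (exp (u / 2) * exp (- u))" by (simp add: D_def mult_ac)
    also have "exp (u / 2) * exp (- u) = exp (- t / 2) ^ Suc N"
      by (simp add: u_def algebra_simps flip: exp_add exp_of_nat_mult)
    also have "D * \<dots> = D * y * y ^ N" by (simp add: y_def)
    finally show ?thesis .
  qed
  have geo: "(\<lambda>N. D * y * y ^ N) sums (D * y * (1 / (1 - y)))"
    using y by (intro sums_mult geometric_sums) auto
  have sumS: "summable (\<lambda>N. S N * x ^ N)"
    by (rule summable_comparison_test'[OF sums_summable[OF geo], of 0])
       (use term_le S0 x in \<open>auto simp: abs_mult\<close>)
  define G where "G = suminf (\<lambda>N. S N * x ^ N)"
  have G: "(\<lambda>N. S N * x ^ N) sums G" unfolding G_def using sumS by (rule summable_sums)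
  have "G \<le> D * y * (1 / (1 - y))"
    using sums_le[OF term_le G geo] .
  also have "\<dots> = D * (y / (1 - y))" by simp
  also have "y / (1 - y) \<le> 2 / t"
  proof -
    have "1 + t / 2 \<le> exp (t / 2)" by (rule exp_ge_add_one_self)
    then have "y * (1 + t / 2) \<le> y * exp (t / 2)" using y by (intro mult_left_mono) auto
    also have "\<dots> = 1" by (simp add: y_def flip: exp_add)
    finally have "y * t \<le> 2 * (1 - y)" by (simp add: algebra_simps)
    then show ?thesis using y t by (simp add: field_simps)
  qed
  finally have GD: "G \<le> D * (2 / t)" using \<open>D > 0\<close> by simp
  \<comment> \<open>The series of \<open>S\<close> moved by one place; entry 0 is the empty partial
    sum before index 0.\<close>
  define g where "g = (\<lambda>n. if n = 0 then 0 else S (n - 1) * x ^ n)"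
  have "(\<lambda>n. g (Suc n)) sums (x * G)"
    using sums_mult[OF G, of x] by (simp add: g_def mult_ac)
  then have "g sums (x * G)" using sums_Suc[of g "x * G"] by (simp add: g_def)
  then have "(\<lambda>n. S n * x ^ n - g n) sums (G - x * G)" by (rule sums_diff[OF G])
  moreover have "S n * x ^ n - g n = f n * x ^ n" for n
    by (cases n) (auto simp: S_def g_def algebra_simps)
  ultimately have F: "(\<lambda>n. f n * x ^ n) sums (t * G)" by (simp add: t_def algebra_simps)
  then show "summable (\<lambda>n. f n * x ^ n)" by (rule sums_summable)
  have "(suminf (\<lambda>n. f n * x ^ n)) = t * G" using F by (simp add: sums_iff)
  also have "\<dots> \<le> t * (D * (2 / t))" using GD t by (intro mult_left_mono) auto
  also have "\<dots> = 2 * D" using t by simp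
  finally show "(suminf (\<lambda>n. f n * x ^ n)) \<le> (2 * C * exp 1 * exp (b * ln (2 * b))) * (1 - x) powr (-b)"
    by (simp add: D_def K_def t_def mult_ac)
qed

text \<open>Any exponent above the limit works eventually; a larger constant covers the finitely
  many other indices, where \<open>N + 1\<close> keeps the power at least 1.\<close>

lemma partial_sums_powr_bound:
  fixes S :: "nat \<Rightarrow> real"
  assumes lim: "(\<lambda>N. ln (S N) / ln (real N)) \<longlonglongrightarrow> \<beta>" and pos: "\<forall>\<^sub>F N in sequentially. S N > 0"
    and b: "b > \<beta>" "b > 0"
  shows "\<exists>C>0. \<forall>N. S N \<le> C * real (N + 1) powr b"
proof -
  have "\<forall>\<^sub>F N in sequentially. S N \<le> real (N + 1) powr b"
    using order_tendstoD(2)[OF lim b(1)] pos eventually_ge_at_top[of 2]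
  proof eventually_elim
    case (elim N)
    then have "ln (S N) \<le> b * ln (real N)" by (simp add: divide_less_eq)
    then have "exp (ln (S N)) \<le> exp (b * ln (real N))" by simp
    then have "S N \<le> real N powr b" using elim by (simp add: powr_def)
    also have "\<dots> \<le> real (N + 1) powr b" using b by (intro powr_mono2) auto
    finally show ?case .
  qed
  then obtain M where M: "\<And>N. N \<ge> M \<Longrightarrow> S N \<le> real (N + 1) powr b"
    unfolding eventually_sequentially by blast
  define C where "C = 1 + (\<Sum>N<M. \<bar>S N\<bar>)"
  have "C \<ge> 1" unfolding C_def by (simp add: sum_nonneg)
  have "S N \<le> C * real (N + 1) powr b" for N
  proof (cases "N \<ge> M")
    case True
    have "1 * real (N + 1) powr b \<le> C * real (N + 1) powr b" using \<open>C \<ge> 1\<close> by (intro mult_right_mono) auto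
    then show ?thesis using M[OF True] by linarith
  next
    case False
    have "S N \<le> \<bar>S N\<bar>" by simp
    also have "\<dots> \<le> (\<Sum>N<M. \<bar>S N\<bar>)" using False by (intro member_le_sum) auto
    also have "\<dots> \<le> C * 1" by (simp add: C_def)
    also have "\<dots> \<le> C * real (N + 1) powr b"
      using b \<open>C \<ge> 1\<close> by (intro mult_left_mono ge_one_powr_ge_zero) auto
    finally show ?thesis .
  qed
  then show ?thesis using \<open>C \<ge> 1\<close> by (intro exI[of _ C]) auto
qed

text \<open>From below, nonnegativity gives \<open>F x >= x ^ N * S N\<close> for every
  \<open>N\<close>, and one well-chosen \<open>N\<close> suffices. From above, the summation by
  parts applies with each exponent exceeding \<open>\<beta>\<close>.\<close>

lemma abelian_log_limit:
  fixes f :: "nat \<Rightarrow> real"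
  defines "S \<equiv> \<lambda>N. \<Sum>n\<le>N. f n"
  assumes nonneg: "\<And>n. f n \<ge> 0"
    and lim: "(\<lambda>N. ln (S N) / ln (real N)) \<longlonglongrightarrow> \<beta>" and "\<beta> \<ge> 0"
    and Spos: "\<forall>\<^sub>F N in sequentially. S N > 0"
  shows "\<And>x. 0 < x \<Longrightarrow> x < 1 \<Longrightarrow> summable (\<lambda>n. f n * x ^ n)"
    and "\<forall>\<^sub>F x in at_left 1. (suminf (\<lambda>n. f n * x ^ n)) > 0"
    and "((\<lambda>x. ln (suminf (\<lambda>n. f n * x ^ n)) / ln (1 / (1 - x))) \<longlongrightarrow> \<beta>) (at_left 1)"
proof -
  define F where "F = (\<lambda>x. suminf (\<lambda>n. f n * x ^ n))"
  have upper: "\<exists>C>0. \<forall>x. 0 < x \<longrightarrow> x < 1 \<longrightarrow> summable (\<lambda>n. f n * x ^ n) \<and> F x \<le> C * (1 - x) powr (-b)"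
    if b: "b > \<beta>" for b
  proof -
    have "b > 0" using b assms by simp
    obtain C where C: "C > 0" "\<And>N. S N \<le> C * real (N + 1) powr b"
      using partial_sums_powr_bound[OF lim Spos b \<open>b > 0\<close>] by blast
    show ?thesis
      using abelian_upper_bound[of f b C, OF nonneg \<open>b > 0\<close> C(1) C(2)[unfolded S_def]] C(1)
      unfolding F_def by (intro exI[of _ "2 * C * exp 1 * exp (b * ln (2 * b))"]) auto
  qed
  show summable: "summable (\<lambda>n. f n * x ^ n)" if "0 < x" "x < 1" for x
    using upper[of "\<beta> + 1"] that by auto
  have x01: "\<forall>\<^sub>F x::real in at_left 1. 0 < x \<and> x < 1"
    using eventually_at_left_real[of 0 "1::real"] by (auto elim: eventually_mono)
  have F_ge: "x ^ N * S N \<le> F x" if "0 < x" "x < 1" for x N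
  proof -
    have "x ^ N * S N = (\<Sum>n\<le>N. f n * x ^ N)" by (simp add: S_def sum_distrib_left mult.commute)
    also have "\<dots> \<le> (\<Sum>n\<le>N. f n * x ^ n)"
      using that nonneg by (intro sum_mono mult_left_mono power_decreasing) auto
    also have "\<dots> \<le> F x" unfolding F_def
      using that nonneg by (intro sum_le_suminf summable) auto
    finally show ?thesis .
  qed
  \<comment> \<open>At this size \<open>x ^ N\<close> stays bounded below while \<open>ln N\<close>
    is asymptotic to \<open>ln (1 / (1 - x))\<close>.\<close>
  define N where "N = (\<lambda>x::real. nat \<lfloor>1 / (1 - x)\<rfloor>)"
  have N: "filterlim N at_top (at_left 1)"
  proof -
    have "filterlim (\<lambda>x::real. \<lfloor>1 / (1 - x)\<rfloor>) at_top (at_left 1)" 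
      by (rule filterlim_compose[OF filterlim_floor_sequentially]) real_asymp
    then show ?thesis unfolding N_def by (rule filterlim_compose[OF filterlim_nat_sequentially])
  qed
  have "((\<lambda>x::real. x powr (1 / (1 - x))) \<longlongrightarrow> exp (-1)) (at_left 1)" by real_asymp
  \<comment> \<open>Any positive constant below \<open>exp (-1)\<close> would serve;
    \<open>1 / 4\<close> follows from \<open>exp 1 <= 3\<close>.\<close>
  moreover have "exp (-1) > (1 / 4 :: real)"
    using exp_le by (simp add: exp_minus field_simps)
  ultimately have quarter: "\<forall>\<^sub>F x::real in at_left 1. x powr (1 / (1 - x)) > 1 / 4"
    by (rule order_tendstoD(1))
  have SN: "\<forall>\<^sub>F x in at_left 1. S (N x) > 0"
    using eventually_compose_filterlim[OF Spos N] .
  have lower: "\<forall>\<^sub>F x in at_left 1. F x \<ge> S (N x) / 4 \<and> F x > 0"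
    using x01 quarter SN
  proof eventually_elim
    case (elim x)
    have "real (N x) \<le> 1 / (1 - x)" unfolding N_def using elim by (simp add: of_nat_floor)
    then have "x powr (1 / (1 - x)) \<le> x powr real (N x)"
      using elim by (intro powr_mono') auto
    then have "1 / 4 \<le> x ^ N x" using elim by (simp add: powr_realpow)
    then have "1 / 4 * S (N x) \<le> x ^ N x * S (N x)" using elim by (intro mult_right_mono) auto
    also have "\<dots> \<le> F x" using elim by (intro F_ge) auto
    finally show ?case using elim by auto
  qed
  then show "\<forall>\<^sub>F x in at_left 1. (suminf (\<lambda>n. f n * x ^ n)) > 0"
    unfolding F_def by (auto elim: eventually_mono)
  have L0: "\<forall>\<^sub>F x::real in at_left 1. ln (1 / (1 - x)) > 0" by real_asymp
  have limN: "((\<lambda>x. ln (S (N x)) / ln (real (N x))) \<longlongrightarrow> \<beta>) (at_left 1)"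
    using filterlim_compose[OF lim N] .
  have ratio: "((\<lambda>x. ln (real (N x)) / ln (1 / (1 - x))) \<longlongrightarrow> 1) (at_left 1)"
  proof -
    have "((\<lambda>x::real. ln (of_int \<lfloor>1 / (1 - x)\<rfloor>) / ln (1 / (1 - x))) \<longlongrightarrow> 1) (at_left 1)" by real_asymp
    then show ?thesis
    proof (rule Lim_transform_eventually)
      show "\<forall>\<^sub>F x in at_left 1. ln (of_int \<lfloor>1 / (1 - x)\<rfloor>) / ln (1 / (1 - x)) = ln (real (N x)) / ln (1 / (1 - x))"
        using x01 by eventually_elim (simp add: N_def)
    qed
  qed
  have "((\<lambda>x. ln (S (N x)) / ln (real (N x)) * (ln (real (N x)) / ln (1 / (1 - x))) - ln 4 / ln (1 / (1 - x))) \<longlongrightarrow> \<beta> * 1 - 0) (at_left 1)"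
    by (intro tendsto_diff tendsto_mult limN ratio) real_asymp
  then have lim_low: "((\<lambda>x. ln (S (N x)) / ln (real (N x)) * (ln (real (N x)) / ln (1 / (1 - x))) - ln 4 / ln (1 / (1 - x))) \<longlongrightarrow> \<beta>) (at_left 1)"
    by simp
  have "\<forall>\<^sub>F x in at_left 1. N x \<ge> 2" using N by (auto simp: filterlim_at_top)
  then have low: "\<forall>\<^sub>F x in at_left 1. ln (S (N x)) / ln (real (N x)) * (ln (real (N x)) / ln (1 / (1 - x))) - ln 4 / ln (1 / (1 - x)) \<le> ln (F x) / ln (1 / (1 - x))"
    using lower SN L0
  proof eventually_elim
    case (elim x)
    have "ln (S (N x) / 4) \<le> ln (F x)" using elim by (subst ln_le_cancel_iff) auto
    then have "ln (S (N x)) - ln 4 \<le> ln (F x)" using elim by (simp add: ln_div)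
    then have "(ln (S (N x)) - ln 4) / ln (1 / (1 - x)) \<le> ln (F x) / ln (1 / (1 - x))"
      using elim by (intro divide_right_mono) auto
    moreover have "ln (real (N x)) \<noteq> 0" using elim by simp
    ultimately show ?case by (simp add: diff_divide_distrib)
  qed
  have "((\<lambda>x. ln (F x) / ln (1 / (1 - x))) \<longlongrightarrow> \<beta>) (at_left 1)"
  proof (rule order_tendstoI)
    fix l assume "l < \<beta>"
    from eventually_conj[OF order_tendstoD(1)[OF lim_low this] low]
    show "\<forall>\<^sub>F x in at_left 1. l < ln (F x) / ln (1 / (1 - x))"
      by (rule eventually_mono) linarith
  next
    fix u assume u: "\<beta> < u"
    \<comment> \<open>The margin between \<open>b\<close> and \<open>u\<close> absorbs
      \<open>ln C / ln (1 / (1 - x))\<close>, which tends to 0.\<close>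
    define b where "b = (\<beta> + u) / 2"
    have b: "\<beta> < b" "b < u" using u by (auto simp: b_def)
    obtain C where C: "C > 0" "\<And>x. 0 < x \<Longrightarrow> x < 1 \<Longrightarrow> F x \<le> C * (1 - x) powr (-b)"
      using upper[OF b(1)] by blast
    have "((\<lambda>x::real. ln C / ln (1 / (1 - x)) + b) \<longlongrightarrow> 0 + b) (at_left 1)"
      by (intro tendsto_add tendsto_const) real_asymp
    then have "\<forall>\<^sub>F x::real in at_left 1. ln C / ln (1 / (1 - x)) + b < u"
      using b by (intro order_tendstoD(2)) auto
    then show "\<forall>\<^sub>F x in at_left 1. ln (F x) / ln (1 / (1 - x)) < u"
      using x01 lower L0
    proof eventually_elim
      case (elim x)
      have "ln (F x) \<le> ln (C * (1 - x) powr (-b))"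
        using elim C by (subst ln_le_cancel_iff) auto
      also have "\<dots> = ln C + b * ln (1 / (1 - x))"
        using elim C by (simp add: ln_mult ln_powr ln_div)
      finally have "ln (F x) / ln (1 / (1 - x)) \<le> (ln C + b * ln (1 / (1 - x))) / ln (1 / (1 - x))"
        using elim by (intro divide_right_mono) auto
      also have "\<dots> = ln C / ln (1 / (1 - x)) + b" using elim by (simp add: add_divide_distrib)
      finally show ?case using elim by linarith
    qed
  qed
  then show "((\<lambda>x. ln (suminf (\<lambda>n. f n * x ^ n)) / ln (1 / (1 - x))) \<longlongrightarrow> \<beta>) (at_left 1)"
    by (simp only: F_def)
qed

subsection \<open>Quotients of entire functions\<close>

text \<open>Entire functions appear as power series of infinite radius, so that they live in the
  ambient field of Laurent series. Weierstrass places every meromorphic function here, and finitely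
  many members share a denominator.\<close>

definition entire_quotients :: "complex fls set" where
  "entire_quotients = {fps_to_fls p / fps_to_fls q | p q. fps_conv_radius p = \<infinity> \<and> fps_conv_radius q = \<infinity> \<and> q \<noteq> 0}"

lemma entire_quotientsI:
  "fps_conv_radius p = \<infinity> \<Longrightarrow> fps_conv_radius q = \<infinity> \<Longrightarrow> fps_to_fls p / fps_to_fls q \<in> entire_quotients"
proof (cases "q = 0")
  case True
  then have "fps_to_fls p / fps_to_fls q = fps_to_fls 0 / fps_to_fls 1" by simp
  also have "\<dots> \<in> entire_quotients"
    unfolding entire_quotients_def using fps_conv_radius_0 fps_conv_radius_1 one_neq_zero by blast
  finally show ?thesis .
qed (auto simp: entire_quotients_def)

lemma fps_conv_radius_mult_infinity:
  "fps_conv_radius p = \<infinity> \<Longrightarrow> fps_conv_radius q = \<infinity> \<Longrightarrow> fps_conv_radius (p * q :: complex fps) = \<infinity>"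
  using fps_conv_radius_mult[of p q] by simp

lemma fps_conv_radius_add_infinity:
  "fps_conv_radius p = \<infinity> \<Longrightarrow> fps_conv_radius q = \<infinity> \<Longrightarrow> fps_conv_radius (p + q :: complex fps) = \<infinity>"
  using fps_conv_radius_add[of p q] by simp

lemma fps_conv_radius_prod_infinity:
  "(\<And>i. i \<in> I \<Longrightarrow> fps_conv_radius (g i) = \<infinity>) \<Longrightarrow> fps_conv_radius (\<Prod>i\<in>I. g i :: complex fps) = \<infinity>"
  by (induction I rule: infinite_finite_induct) (auto intro: fps_conv_radius_mult_infinity)

lemma rational_functions_subset: "rational_functions \<subseteq> entire_quotients"
  unfolding rational_functions_def by (auto intro!: entire_quotientsI)

text \<open>\<open>g\<close> may have stray values on a discrete set; \<open>remove_sings\<close>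
  normalises it so that the Weierstrass factorisation applies, without altering the Laurent
  expansion at 0.\<close>

lemma meromorphic_functions_subset: "meromorphic_functions \<subseteq> entire_quotients"
proof
  fix y assume "y \<in> meromorphic_functions"
  then obtain g where g: "y = laurent_expansion g 0" "g meromorphic_on UNIV"
    by (auto simp: meromorphic_functions_def)
  have iso: "isolated_singularity_at g 0"
    using g(2) by (auto intro: meromorphic_on_isolated_singularity meromorphic_on_subset)
  obtain h f1 f2 where h: "h holomorphic_on UNIV" "f1 holomorphic_on UNIV" "f2 holomorphic_on UNIV"
    and eq: "\<forall>z. remove_sings g z = h z * f1 z / f2 z"
    using weierstrass_factorization_meromorphic_UNIV[OF remove_sings_nicely_meromorphic[OF g(2)]] by metis
  define p where "p = fps_expansion (\<lambda>z. h z * f1 z) 0"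
  define q where "q = fps_expansion f2 0"
  have hf: "(\<lambda>z. h z * f1 z) holomorphic_on UNIV" by (intro holomorphic_intros h)
  have radius: "fps_conv_radius p = \<infinity>" "fps_conv_radius q = \<infinity>"
    using conv_radius_fps_expansion[of "\<lambda>z. h z * f1 z" 0 \<infinity>] conv_radius_fps_expansion[of f2 0 \<infinity>] hf h(3)
    by (auto simp: p_def q_def)
  have "(\<lambda>z. (h z * f1 z) / f2 z) has_laurent_expansion fps_to_fls p / fps_to_fls q"
    unfolding p_def q_def using hf h(3)
    by (intro has_laurent_expansion_divide has_laurent_expansion_fps has_fps_expansion_fps_expansion[of UNIV]) auto
  also have "(\<lambda>z. (h z * f1 z) / f2 z) = (\<lambda>z. remove_sings g (0 + z))"
    using eq by auto
  finally have "laurent_expansion (remove_sings g) 0 = fps_to_fls p / fps_to_fls q"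
    by (rule laurent_expansion_eqI)
  moreover have "laurent_expansion (remove_sings g) 0 = laurent_expansion g 0"
    using eventually_remove_sings_eq_at[OF iso] by (intro laurent_expansion_cong) auto
  ultimately show "y \<in> entire_quotients" using g(1) radius by (auto intro: entire_quotientsI)
qed

lemma field_adjoin_subset_entire_quotients:
  "field_adjoin rational_functions meromorphic_functions \<subseteq> entire_quotients"
proof
  fix y assume "y \<in> field_adjoin rational_functions meromorphic_functions"
  then show "y \<in> entire_quotients"
  proof (induction rule: field_adjoin_induct)
    case one
    then show ?case using entire_quotientsI[of 1 1] by simp
  next
    case (base x)
    then show ?case using rational_functions_subset meromorphic_functions_subset by blast
  next
    case (uminus x)
    then obtain p q where x: "x = fps_to_fls p / fps_to_fls q" "fps_conv_radius p = \<infinity>" "fps_conv_radius q = \<infinity>"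
      by (auto simp: entire_quotients_def)
    then show ?case using entire_quotientsI[of "-p" q] by simp
  next
    case (inverse x)
    then obtain p q where x: "x = fps_to_fls p / fps_to_fls q" "fps_conv_radius p = \<infinity>" "fps_conv_radius q = \<infinity>"
      by (auto simp: entire_quotients_def)
    then show ?case using entire_quotientsI[of q p] by (simp add: divide_inverse mult.commute)
  next
    case (add x y)
    then obtain p q r s where x: "x = fps_to_fls p / fps_to_fls q" "fps_conv_radius p = \<infinity>" "fps_conv_radius q = \<infinity>" "q \<noteq> 0"
      and y: "y = fps_to_fls r / fps_to_fls s" "fps_conv_radius r = \<infinity>" "fps_conv_radius s = \<infinity>" "s \<noteq> 0"
      by (auto simp: entire_quotients_def)
    have "x + y = fps_to_fls (p * s + r * q) / fps_to_fls (q * s)"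
      using x(4) y(4) unfolding x(1) y(1) by (simp add: fls_times_fps_to_fls add_frac_eq)
    moreover have "fps_to_fls (p * s + r * q) / fps_to_fls (q * s) \<in> entire_quotients"
      using x y by (intro entire_quotientsI fps_conv_radius_mult_infinity fps_conv_radius_add_infinity)
    ultimately show ?case by simp
  next
    case (mult x y)
    then obtain p q r s where x: "x = fps_to_fls p / fps_to_fls q" "fps_conv_radius p = \<infinity>" "fps_conv_radius q = \<infinity>" "q \<noteq> 0"
      and y: "y = fps_to_fls r / fps_to_fls s" "fps_conv_radius r = \<infinity>" "fps_conv_radius s = \<infinity>" "s \<noteq> 0"
      by (auto simp: entire_quotients_def)
    have "x * y = fps_to_fls (p * r) / fps_to_fls (q * s)"
      unfolding x(1) y(1) by (simp add: fls_times_fps_to_fls)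
    then show ?case using x y by (auto intro!: entire_quotientsI fps_conv_radius_mult_infinity)
  qed
qed

lemma entire_quotients_common_denominator:
  assumes "finite E" "\<And>e. e \<in> E \<Longrightarrow> c e \<in> entire_quotients"
  shows "\<exists>Q P. Q \<noteq> 0 \<and> (\<forall>e\<in>E. fps_conv_radius (P e) = \<infinity> \<and> c e * fps_to_fls Q = fps_to_fls (P e))"
proof -
  have "\<forall>e\<in>E. \<exists>p q. c e = fps_to_fls p / fps_to_fls q \<and> fps_conv_radius p = \<infinity> \<and> fps_conv_radius q = \<infinity> \<and> q \<noteq> 0"
    using assms(2) by (force simp: entire_quotients_def)
  then obtain p q where pq: "\<And>e. e \<in> E \<Longrightarrow> c e = fps_to_fls (p e) / fps_to_fls (q e)"
    "\<And>e. e \<in> E \<Longrightarrow> fps_conv_radius (p e) = \<infinity>" "\<And>e. e \<in> E \<Longrightarrow> fps_conv_radius (q e) = \<infinity>" "\<And>e. e \<in> E \<Longrightarrow> q e \<noteq> 0"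
    by metis
  define Q where "Q = (\<Prod>e\<in>E. q e)"
  define P where "P = (\<lambda>e. p e * (\<Prod>e'\<in>E - {e}. q e'))"
  have "Q \<noteq> 0" using assms(1) pq(4) by (simp add: Q_def)
  moreover have "fps_conv_radius (P e) = \<infinity>" if "e \<in> E" for e
    unfolding P_def using that pq(2,3) by (intro fps_conv_radius_mult_infinity fps_conv_radius_prod_infinity) auto
  moreover have "c e * fps_to_fls Q = fps_to_fls (P e)" if "e \<in> E" for e
  proof -
    have "Q = q e * (\<Prod>e'\<in>E - {e}. q e')" unfolding Q_def using assms(1) that by (rule prod.remove)
    then show ?thesis using pq(1,4)[OF that] by (simp add: P_def fls_times_fps_to_fls)
  qed
  ultimately show ?thesis by blast
qed

subsection \<open>Logarithmic order at 1\<close>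

text \<open>The exponent in \<open>norm (g x) = (1 - x) powr (- \<theta> + o(1))\<close>. Eventual
  nonvanishing is demanded because \<open>ln 0\<close> has the default value 0, which would give the
  zero function order 0.\<close>

definition has_log_order :: "(real \<Rightarrow> complex) \<Rightarrow> real \<Rightarrow> bool" where
  "has_log_order g \<theta> \<longleftrightarrow> (\<forall>\<^sub>F x in at_left 1. g x \<noteq> 0) \<and>
     ((\<lambda>x. ln (norm (g x)) / ln (1 / (1 - x))) \<longlongrightarrow> \<theta>) (at_left 1)"

lemma has_log_order_1: "has_log_order (\<lambda>_. 1) 0"
  by (simp add: has_log_order_def)

lemma has_log_order_mult:
  assumes "has_log_order g \<theta>" "has_log_order h \<eta>"
  shows "has_log_order (\<lambda>x. g x * h x) (\<theta> + \<eta>)"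
proof -
  have nz: "\<forall>\<^sub>F x in at_left 1. g x \<noteq> 0" "\<forall>\<^sub>F x in at_left 1. h x \<noteq> 0"
    using assms by (auto simp: has_log_order_def)
  have "((\<lambda>x. ln (norm (g x)) / ln (1 / (1 - x)) + ln (norm (h x)) / ln (1 / (1 - x))) \<longlongrightarrow> \<theta> + \<eta>) (at_left 1)"
    using assms by (intro tendsto_add) (auto simp: has_log_order_def)
  moreover have "\<forall>\<^sub>F x in at_left 1. ln (norm (g x)) / ln (1 / (1 - x)) + ln (norm (h x)) / ln (1 / (1 - x))
      = ln (norm (g x * h x)) / ln (1 / (1 - x))"
    using nz by eventually_elim (simp add: norm_mult ln_mult add_divide_distrib)
  ultimately have "((\<lambda>x. ln (norm (g x * h x)) / ln (1 / (1 - x))) \<longlongrightarrow> \<theta> + \<eta>) (at_left 1)"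
    by (rule Lim_transform_eventually)
  moreover have "\<forall>\<^sub>F x in at_left 1. g x * h x \<noteq> 0" using nz by eventually_elim simp
  ultimately show ?thesis by (simp add: has_log_order_def)
qed

lemma has_log_order_inverse:
  assumes "has_log_order g \<theta>"
  shows "has_log_order (\<lambda>x. inverse (g x)) (- \<theta>)"
proof -
  have "((\<lambda>x. - (ln (norm (g x)) / ln (1 / (1 - x)))) \<longlongrightarrow> - \<theta>) (at_left 1)"
    using assms by (intro tendsto_minus) (auto simp: has_log_order_def)
  moreover have "ln (norm (inverse (g x))) = - ln (norm (g x))" for x
    by (cases "g x = 0") (simp_all add: norm_inverse ln_inverse)
  ultimately show ?thesis using assms by (simp add: has_log_order_def)
qed

lemma has_log_order_power:
  "has_log_order g \<theta> \<Longrightarrow> has_log_order (\<lambda>x. g x ^ n) (real n * \<theta>)"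
proof (induction n)
  case (Suc n)
  then have "has_log_order (\<lambda>x. g x * g x ^ n) (\<theta> + real n * \<theta>)" by (intro has_log_order_mult) auto
  then show ?case by (simp add: algebra_simps)
qed (simp add: has_log_order_1)

lemma has_log_order_prod:
  assumes "\<And>i. i \<in> I \<Longrightarrow> has_log_order (g i) (\<theta> i)"
  shows "has_log_order (\<lambda>x. \<Prod>i\<in>I. g i x) (\<Sum>i\<in>I. \<theta> i)"
  using assms by (induction I rule: infinite_finite_induct) (auto intro: has_log_order_1 has_log_order_mult)

lemma has_log_order_negative_tendsto_0:
  assumes "has_log_order g \<theta>" "\<theta> < 0"
  shows "(g \<longlongrightarrow> 0) (at_left 1)"
proof -
  have L: "\<forall>\<^sub>F x::real in at_left 1. ln (1 / (1 - x)) > 0" by real_asymp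
  \<comment> \<open>Strictly between \<open>\<theta>\<close> and 0, so that
    \<open>norm (g x)\<close> is eventually at most the positive power
    \<open>(1 - x) powr (- c)\<close>.\<close>
  define c where "c = \<theta> / 2"
  have c: "\<theta> < c" "c < 0" using assms(2) by (auto simp: c_def)
  have lim: "((\<lambda>x. ln (norm (g x)) / ln (1 / (1 - x))) \<longlongrightarrow> \<theta>) (at_left 1)"
    and nz: "\<forall>\<^sub>F x in at_left 1. g x \<noteq> 0" using assms by (auto simp: has_log_order_def)
  have "\<forall>\<^sub>F x in at_left 1. norm (g x) \<le> exp (c * ln (1 / (1 - x)))"
    using order_tendstoD(2)[OF lim c(1)] nz L
  proof eventually_elim
    case (elim x)
    then have "ln (norm (g x)) \<le> c * ln (1 / (1 - x))" by (simp add: divide_less_eq)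
    then have "exp (ln (norm (g x))) \<le> exp (c * ln (1 / (1 - x)))" by simp
    then show ?case using elim by simp
  qed
  moreover have "((\<lambda>x::real. exp (c * ln (1 / (1 - x)))) \<longlongrightarrow> 0) (at_left 1)"
    using c(2) by real_asymp
  ultimately show ?thesis by (rule Lim_null_comparison)
qed

text \<open>After division by the term of largest order all others tend to 0, whereas a vanishing
  sum would make them add up to \<open>-1\<close>.\<close>

lemma sum_distinct_log_orders_nonzero:
  assumes "finite E" "E \<noteq> {}" "\<And>e. e \<in> E \<Longrightarrow> has_log_order (t e) (\<theta> e)" "inj_on \<theta> E"
  shows "\<not> (\<forall>\<^sub>F x in at_left 1. (\<Sum>e\<in>E. t e x) = 0)"
proof
  assume zero: "\<forall>\<^sub>F x in at_left 1. (\<Sum>e\<in>E. t e x) = 0"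
  have "Max (\<theta> ` E) \<in> \<theta> ` E" using assms by (intro Max_in) auto
  then obtain e0 where e0: "e0 \<in> E" "\<theta> e0 = Max (\<theta> ` E)" by auto
  have less: "\<theta> e < \<theta> e0" if "e \<in> E - {e0}" for e
  proof -
    have "\<theta> e \<le> \<theta> e0" unfolding e0(2) using that assms(1) by auto
    moreover have "\<theta> e \<noteq> \<theta> e0" using that e0(1) assms(4) by (auto dest: inj_onD)
    ultimately show ?thesis by simp
  qed
  have "((\<lambda>x. \<Sum>e\<in>E - {e0}. t e x * inverse (t e0 x)) \<longlongrightarrow> (\<Sum>e\<in>E - {e0}. 0)) (at_left 1)"
  proof (intro tendsto_sum)
    fix e assume e: "e \<in> E - {e0}"
    have "has_log_order (\<lambda>x. t e x * inverse (t e0 x)) (\<theta> e + - \<theta> e0)"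
      using e e0(1) assms(3) by (intro has_log_order_mult has_log_order_inverse) auto
    then show "((\<lambda>x. t e x * inverse (t e0 x)) \<longlongrightarrow> 0) (at_left 1)"
      by (rule has_log_order_negative_tendsto_0) (use less[OF e] in simp)
  qed
  moreover have "\<forall>\<^sub>F x in at_left 1. (\<Sum>e\<in>E - {e0}. t e x * inverse (t e0 x)) = -1"
  proof -
    have "\<forall>\<^sub>F x in at_left 1. t e0 x \<noteq> 0" using assms(3)[OF e0(1)] by (simp add: has_log_order_def)
    then show ?thesis using zero
    proof eventually_elim
      case (elim x)
      have "(\<Sum>e\<in>E. t e x) = t e0 x + (\<Sum>e\<in>E - {e0}. t e x)"
        using assms(1) e0(1) by (rule sum.remove)
      then have "(\<Sum>e\<in>E - {e0}. t e x) = - t e0 x"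
        using elim by (simp add: eq_neg_iff_add_eq_0 add.commute)
      then show ?case using elim by (simp flip: sum_distrib_right)
    qed
  qed
  ultimately have "((\<lambda>x::real. -1 :: complex) \<longlongrightarrow> 0) (at_left 1)"
    by (simp add: tendsto_cong)
  then show False by (auto simp: tendsto_const_iff)
qed

text \<open>Near 1 the function is \<open>(w - 1) ^ n * g w\<close> with \<open>g 1\<close> nonzero,
  so the order is minus the multiplicity of the zero.\<close>

lemma entire_has_log_order:
  fixes H :: "complex fps"
  assumes "fps_conv_radius H = \<infinity>" "H \<noteq> 0"
  shows "\<exists>n::nat. has_log_order (\<lambda>x. eval_fps H (of_real x)) (- real n)"
proof -
  define h where "h = eval_fps H"
  have hol: "h holomorphic_on UNIV" unfolding h_def using assms by (intro holomorphic_on_eval_fps) auto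
  have "\<exists>n r g. r > 0 \<and> g holomorphic_on ball 1 r \<and> (\<forall>w\<in>ball 1 r. h w = (w - 1) ^ n * g w \<and> g w \<noteq> 0)"
  proof (cases "h 1 = 0")
    case True
    \<comment> \<open>A constant function with a zero at 1 vanishes everywhere, which forces
      \<open>H = 0\<close>.\<close>
    have "\<not> h constant_on UNIV"
    proof
      assume "h constant_on UNIV"
      then have "h w = 0" for w using True by (auto simp: constant_on_def)
      then have "H = 0" using assms by (intro eval_fps_eqD) (auto simp: h_def)
      then show False using assms by simp
    qed
    then show ?thesis
      using holomorphic_factor_zero_nonconstant[OF hol, of 1] True by (metis UNIV_I connected_UNIV open_UNIV)
  next
    case False
    have "continuous (at 1) h"
      using hol holomorphic_on_imp_continuous_on continuous_on_eq_continuous_at by blast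
    then obtain r where "r > 0" "\<forall>w. dist 1 w < r \<longrightarrow> h w \<noteq> 0"
      using continuous_at_avoid[of 1 h 0] False by auto
    then show ?thesis using holomorphic_on_subset[OF hol]
      by (intro exI[of _ 0] exI[of _ r] exI[of _ h]) auto
  qed
  then obtain n r g where r: "r > 0" and g: "g holomorphic_on ball 1 r"
    "\<And>w. w \<in> ball 1 r \<Longrightarrow> h w = (w - 1) ^ n * g w" "\<And>w. w \<in> ball 1 r \<Longrightarrow> g w \<noteq> 0" by blast
  have near: "\<forall>\<^sub>F x::real in at_left 1. complex_of_real x \<in> ball 1 r \<and> x < 1"
  proof -
    have "\<forall>\<^sub>F x::real in at_left 1. x \<in> {1 - r<..<1}" by (intro eventually_at_left_real) (use r in auto)
    then show ?thesis
    proof eventually_elim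
      case (elim x)
      have "dist 1 (complex_of_real x) = \<bar>1 - x\<bar>" by (metis dist_of_real dist_real_def of_real_1)
      then show ?case using elim by auto
    qed
  qed
  have "isCont g 1"
    using g(1) r holomorphic_on_imp_continuous_on[OF g(1)] by (simp add: continuous_on_eq_continuous_at)
  moreover have "((\<lambda>x. complex_of_real x) \<longlongrightarrow> 1) (at_left 1)"
    by (rule tendsto_eq_intros refl | simp)+
  ultimately have "((\<lambda>x. g (complex_of_real x)) \<longlongrightarrow> g 1) (at_left 1)"
    by (rule isCont_tendsto_compose)
  then have lng: "((\<lambda>x. ln (norm (g (complex_of_real x)))) \<longlongrightarrow> ln (norm (g 1))) (at_left 1)"
    using g(3)[of 1] r by (intro tendsto_ln tendsto_norm) auto
  have "((\<lambda>x::real. 1 / ln (1 / (1 - x))) \<longlongrightarrow> 0) (at_left 1)" by real_asymp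
  then have "((\<lambda>x. - real n + ln (norm (g (complex_of_real x))) * (1 / ln (1 / (1 - x)))) \<longlongrightarrow> - real n + ln (norm (g 1)) * 0) (at_left 1)"
    by (intro tendsto_add tendsto_const tendsto_mult lng)
  then have lim: "((\<lambda>x. - real n + ln (norm (g (complex_of_real x))) * (1 / ln (1 / (1 - x)))) \<longlongrightarrow> - real n) (at_left 1)"
    by simp
  have L: "\<forall>\<^sub>F x::real in at_left 1. ln (1 / (1 - x)) > 0" by real_asymp
  have "((\<lambda>x. ln (norm (h (of_real x))) / ln (1 / (1 - x))) \<longlongrightarrow> - real n) (at_left 1)"
    using lim
  proof (rule Lim_transform_eventually)
    show "\<forall>\<^sub>F x in at_left 1. - real n + ln (norm (g (complex_of_real x))) * (1 / ln (1 / (1 - x)))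
        = ln (norm (h (of_real x))) / ln (1 / (1 - x))"
      using near L
    proof eventually_elim
      case (elim x)
      have "norm (complex_of_real x - 1) = 1 - x"
        using elim by (metis abs_minus_commute abs_of_pos diff_gt_0_iff_gt norm_of_real of_real_1 of_real_diff)
      then have "norm (h (of_real x)) = (1 - x) ^ n * norm (g (of_real x))"
        using g(2)[of "of_real x"] elim by (simp add: norm_mult norm_power)
      then have "ln (norm (h (of_real x))) = real n * ln (1 - x) + ln (norm (g (of_real x)))"
        using g(3)[of "of_real x"] elim by (simp add: ln_mult ln_realpow)
      also have "ln (1 - x) = - ln (1 / (1 - x))" using elim by (simp add: ln_div)
      finally show ?case using elim by (simp add: field_simps)
    qed
  qed
  moreover have "\<forall>\<^sub>F x in at_left 1. h (of_real x) \<noteq> 0"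
    using near
  proof eventually_elim
    case (elim x)
    then have "complex_of_real x - 1 \<noteq> 0" by (auto simp: complex_eq_iff)
    then show ?case using g(2,3)[of "of_real x"] elim by simp
  qed
  ultimately show ?thesis unfolding has_log_order_def h_def by blast
qed

subsection \<open>Algebraic independence\<close>

text \<open>Radius and value are proved together: evaluating one more summand requires the radius of
  the remaining sum.\<close>

lemma eval_fps_sum_unit_disc:
  fixes g :: "'i \<Rightarrow> complex fps"
  assumes "\<And>i. i \<in> I \<Longrightarrow> fps_conv_radius (g i) \<ge> 1"
  shows "fps_conv_radius (\<Sum>i\<in>I. g i) \<ge> 1 \<and> (\<forall>z. norm z < 1 \<longrightarrow> eval_fps (\<Sum>i\<in>I. g i) z = (\<Sum>i\<in>I. eval_fps (g i) z))"
  using assms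
proof (induction I rule: infinite_finite_induct)
  case (insert i I)
  have r: "fps_conv_radius (g i) \<ge> 1" "fps_conv_radius (\<Sum>i\<in>I. g i) \<ge> 1" using insert by auto
  then have "fps_conv_radius (g i + (\<Sum>i\<in>I. g i)) \<ge> 1"
    using fps_conv_radius_add[of "g i" "\<Sum>i\<in>I. g i"] by (meson min.boundedI order_trans)
  moreover have "eval_fps (g i + (\<Sum>i\<in>I. g i)) z = eval_fps (g i) z + eval_fps (\<Sum>i\<in>I. g i) z" if "norm z < 1" for z
    using r that by (intro eval_fps_add) (auto intro: less_le_trans[of _ 1])
  ultimately show ?case using insert by simp
qed auto

lemma eval_fps_prod_unit_disc:
  fixes g :: "'i \<Rightarrow> complex fps"
  assumes "\<And>i. i \<in> I \<Longrightarrow> fps_conv_radius (g i) \<ge> 1"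
  shows "fps_conv_radius (\<Prod>i\<in>I. g i) \<ge> 1 \<and> (\<forall>z. norm z < 1 \<longrightarrow> eval_fps (\<Prod>i\<in>I. g i) z = (\<Prod>i\<in>I. eval_fps (g i) z))"
  using assms
proof (induction I rule: infinite_finite_induct)
  case (insert i I)
  have r: "fps_conv_radius (g i) \<ge> 1" "fps_conv_radius (\<Prod>i\<in>I. g i) \<ge> 1" using insert by auto
  then have "fps_conv_radius (g i * (\<Prod>i\<in>I. g i)) \<ge> 1"
    using fps_conv_radius_mult[of "g i" "\<Prod>i\<in>I. g i"] by (meson min.boundedI order_trans)
  moreover have "eval_fps (g i * (\<Prod>i\<in>I. g i)) z = eval_fps (g i) z * eval_fps (\<Prod>i\<in>I. g i) z" if "norm z < 1" for z
    using r that by (intro eval_fps_mult) (auto intro: less_le_trans[of _ 1])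
  ultimately show ?case using insert by simp
qed auto

lemma fps_to_fls_sum: "fps_to_fls (\<Sum>i\<in>I. g i) = (\<Sum>i\<in>I. fps_to_fls (g i :: complex fps))"
  by (induction I rule: infinite_finite_induct) auto

lemma fps_to_fls_prod: "fps_to_fls (\<Prod>i\<in>I. g i) = (\<Prod>i\<in>I. fps_to_fls (g i :: complex fps))"
  by (induction I rule: infinite_finite_induct) (auto simp: fls_times_fps_to_fls)

text \<open>Cleared of denominators and evaluated at real \<open>r\<close> increasing to 1, a
  relation becomes a vanishing sum of terms with known orders. The integer \<open>n\<close> in the
  last hypothesis stands for the difference of two zero multiplicities. The index type is general
  because both \<open>{1..d}\<close> and a set of Laurent series are used.\<close>

lemma alg_independent_of_log_orders:
  fixes G :: "'i \<Rightarrow> complex fps" and a :: "'i \<Rightarrow> real"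
  assumes K: "K \<subseteq> entire_quotients" and "finite I"
    and x: "\<And>i. i \<in> I \<Longrightarrow> x i = fps_to_fls (G i)"
    and radius: "\<And>i. i \<in> I \<Longrightarrow> fps_conv_radius (G i) \<ge> 1"
    and order: "\<And>i. i \<in> I \<Longrightarrow> has_log_order (\<lambda>r. eval_fps (G i) (of_real r)) (a i)"
    and indep: "\<And>(e :: 'i \<Rightarrow> int) (n :: int). of_int n + (\<Sum>i\<in>I. of_int (e i) * a i) = 0 \<Longrightarrow> \<forall>i\<in>I. e i = 0"
  shows "alg_independent K I x"
  unfolding alg_independent_def
proof (intro allI impI)
  fix p :: "('i \<Rightarrow>\<^sub>0 nat) \<Rightarrow>\<^sub>0 complex fls"
  assume coeffs: "\<forall>e\<in>Poly_Mapping.keys p. Poly_Mapping.lookup p e \<in> K \<and> Poly_Mapping.keys e \<subseteq> I"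
    and eval: "mpoly_eval x p = 0"
  define E where "E = Poly_Mapping.keys p"
  have finE: "finite E" by (simp add: E_def)
  show "p = 0"
  proof (rule ccontr)
    assume "p \<noteq> 0"
    then have "E \<noteq> {}" by (simp add: E_def)
    have "\<exists>Q P. Q \<noteq> 0 \<and> (\<forall>e\<in>E. fps_conv_radius (P e) = \<infinity> \<and> Poly_Mapping.lookup p e * fps_to_fls Q = fps_to_fls (P e))"
      using finE coeffs K by (intro entire_quotients_common_denominator) (auto simp: E_def)
    then obtain Q P where Q: "Q \<noteq> 0" and P: "\<And>e. e \<in> E \<Longrightarrow> fps_conv_radius (P e) = \<infinity>"
      "\<And>e. e \<in> E \<Longrightarrow> Poly_Mapping.lookup p e * fps_to_fls Q = fps_to_fls (P e)" by blast
    \<comment> \<open>A zero coefficient would have no order at 1.\<close>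
    have P0: "P e \<noteq> 0" if "e \<in> E" for e
    proof -
      have "Poly_Mapping.lookup p e \<noteq> 0" using that by (simp add: E_def in_keys_iff)
      then have "fps_to_fls (P e) \<noteq> 0" using P(2)[OF that] Q by (metis fps_to_fls_eq_0_iff mult_eq_0_iff)
      then show ?thesis by simp
    qed
    define mon where "mon = (\<lambda>e. \<Prod>i\<in>Poly_Mapping.keys e. G i ^ Poly_Mapping.lookup e i)"
    have keysI: "Poly_Mapping.keys e \<subseteq> I" if "e \<in> E" for e using coeffs that by (simp add: E_def)
    have mon: "(\<Prod>i\<in>Poly_Mapping.keys e. x i ^ Poly_Mapping.lookup e i) = fps_to_fls (mon e)" if "e \<in> E" for e
      unfolding mon_def fps_to_fls_prod fps_to_fls_power
      by (intro prod.cong refl arg_cong2[of _ _ _ _ "(^)"] x) (use keysI[OF that] in auto)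
    have "0 = mpoly_eval x p * fps_to_fls Q" using eval by simp
    also have "\<dots> = (\<Sum>e\<in>E. (Poly_Mapping.lookup p e * fps_to_fls Q) * fps_to_fls (mon e))"
      unfolding mpoly_eval_def E_def[symmetric] sum_distrib_right
      by (intro sum.cong refl) (simp add: mon mult_ac)
    also have "\<dots> = (\<Sum>e\<in>E. fps_to_fls (P e * mon e))"
      by (intro sum.cong refl) (simp only: P(2) fls_times_fps_to_fls)
    also have "\<dots> = fps_to_fls (\<Sum>e\<in>E. P e * mon e)" by (simp only: fps_to_fls_sum)
    finally have zero: "(\<Sum>e\<in>E. P e * mon e) = 0" by simp
    have powr1: "fps_conv_radius (G i ^ n) \<ge> 1" if "i \<in> I" for i n
      using radius[OF that] fps_conv_radius_power[of "G i" n] by (rule order_trans)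
    have monr: "fps_conv_radius (mon e) \<ge> 1"
      "\<And>z. norm z < 1 \<Longrightarrow> eval_fps (mon e) z = (\<Prod>i\<in>Poly_Mapping.keys e. eval_fps (G i) z ^ Poly_Mapping.lookup e i)"
      if "e \<in> E" for e
    proof -
      have *: "fps_conv_radius (G i ^ Poly_Mapping.lookup e i) \<ge> 1" if "i \<in> Poly_Mapping.keys e" for i
        using keysI[OF \<open>e \<in> E\<close>] that by (intro powr1) auto
      note ** = eval_fps_prod_unit_disc[of "Poly_Mapping.keys e" "\<lambda>i. G i ^ Poly_Mapping.lookup e i", OF *]
      show "fps_conv_radius (mon e) \<ge> 1" unfolding mon_def using ** by blast
      fix z :: complex assume z: "norm z < 1"
      have "eval_fps (mon e) z = (\<Prod>i\<in>Poly_Mapping.keys e. eval_fps (G i ^ Poly_Mapping.lookup e i) z)"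
        unfolding mon_def using ** z by blast
      also have "\<dots> = (\<Prod>i\<in>Poly_Mapping.keys e. eval_fps (G i) z ^ Poly_Mapping.lookup e i)"
      proof (intro prod.cong refl eval_fps_power)
        fix i assume "i \<in> Poly_Mapping.keys e"
        then have "fps_conv_radius (G i) \<ge> 1" using keysI[OF that] radius by auto
        then show "ereal (norm z) < fps_conv_radius (G i)" using z by (auto intro: less_le_trans[of _ 1])
      qed
      finally show "eval_fps (mon e) z = (\<Prod>i\<in>Poly_Mapping.keys e. eval_fps (G i) z ^ Poly_Mapping.lookup e i)" .
    qed
    define t where "t = (\<lambda>e r. eval_fps (P e) (of_real r) *
      (\<Prod>i\<in>Poly_Mapping.keys e. eval_fps (G i) (complex_of_real r) ^ Poly_Mapping.lookup e i))"
    have "(\<Sum>e\<in>E. t e r) = 0" if "0 < r" "r < 1" for r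
    proof -
      define z where "z = complex_of_real r"
      have z: "norm z < 1" using that by (simp add: z_def)
      have *: "fps_conv_radius (P e * mon e) \<ge> 1" if "e \<in> E" for e
        using fps_conv_radius_mult[of "P e" "mon e"] P(1)[OF that] monr(1)[OF that] by auto
      have "0 = eval_fps (\<Sum>e\<in>E. P e * mon e) z" using zero by simp
      also have "\<dots> = (\<Sum>e\<in>E. eval_fps (P e * mon e) z)"
        using eval_fps_sum_unit_disc[of E "\<lambda>e. P e * mon e", OF *] z by blast
      also have "\<dots> = (\<Sum>e\<in>E. t e r)"
      proof (intro sum.cong refl)
        fix e assume e: "e \<in> E"
        have "ereal (norm z) < fps_conv_radius (mon e)" using monr(1)[OF e] z by (auto intro: less_le_trans[of _ 1])
        then have "eval_fps (P e * mon e) z = eval_fps (P e) z * eval_fps (mon e) z"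
          using P(1)[OF e] by (intro eval_fps_mult) auto
        then show "eval_fps (P e * mon e) z = t e r" using monr(2)[OF e z] by (simp add: t_def z_def)
      qed
      finally show ?thesis by simp
    qed
    then have ev0: "\<forall>\<^sub>F r in at_left 1. (\<Sum>e\<in>E. t e r) = 0"
      using eventually_at_left_real[of 0 1] by (auto elim!: eventually_mono)
    have "\<forall>e\<in>E. \<exists>n::nat. has_log_order (\<lambda>r. eval_fps (P e) (of_real r)) (- real n)"
      using P(1) P0 entire_has_log_order by blast
    then obtain n :: "('i \<Rightarrow>\<^sub>0 nat) \<Rightarrow> nat" where
      n: "\<And>e. e \<in> E \<Longrightarrow> has_log_order (\<lambda>r. eval_fps (P e) (of_real r)) (- real (n e))" by metis
    define \<theta> where "\<theta> = (\<lambda>e. - real (n e) + (\<Sum>i\<in>Poly_Mapping.keys e. real (Poly_Mapping.lookup e i) * a i))"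
    have t: "has_log_order (t e) (\<theta> e)" if e: "e \<in> E" for e
      unfolding t_def \<theta>_def
    proof (intro has_log_order_mult n e has_log_order_prod has_log_order_power order)
      show "i \<in> I" if "i \<in> Poly_Mapping.keys e" for i using keysI[OF e] that by auto
    qed
    have "inj_on \<theta> E"
    proof (rule inj_onI)
      fix e e' assume e: "e \<in> E" "e' \<in> E" "\<theta> e = \<theta> e'"
      have ext: "(\<Sum>i\<in>Poly_Mapping.keys e. real (Poly_Mapping.lookup e i) * a i) = (\<Sum>i\<in>I. real (Poly_Mapping.lookup e i) * a i)"
        if "e \<in> E" for e
        using keysI[OF that] \<open>finite I\<close> by (intro sum.mono_neutral_left) (auto simp: in_keys_iff)
      \<comment> \<open>Differences of exponents may be negative, hence the passage to
        integers.\<close>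
      define m where "m = (\<lambda>i. int (Poly_Mapping.lookup e i) - int (Poly_Mapping.lookup e' i))"
      have "real_of_int (int (n e') - int (n e)) + (\<Sum>i\<in>I. real_of_int (m i) * a i) = \<theta> e - \<theta> e'"
        unfolding \<theta>_def ext[OF e(1)] ext[OF e(2)] m_def by (simp add: algebra_simps sum_subtractf)
      then have "\<forall>i\<in>I. m i = 0" using e(3) by (intro indep[of "int (n e') - int (n e)"]) auto
      then have "Poly_Mapping.lookup e i = Poly_Mapping.lookup e' i" if "i \<in> I" for i
        using that by (simp add: m_def)
      moreover have "Poly_Mapping.lookup e i = Poly_Mapping.lookup e' i" if "i \<notin> I" for i
        using keysI[OF e(1)] keysI[OF e(2)] that by (metis in_keys_iff subsetD)
      ultimately show "e = e'" by (intro poly_mapping_eqI) blast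
    qed
    then show False
      using sum_distinct_log_orders_nonzero[of E t \<theta>] finE \<open>E \<noteq> {}\<close> t ev0 by blast
  qed
qed

subsection \<open>Transcendence degree of a finitely generated field\<close>

text \<open>The degree is bounded in each generator separately, so the exponents form a box with
  \<open>(D + 1) ^ card V\<close> members; \<open>PiE\<close> fixes the values off \<open>V\<close>,
  which keeps the box finite.\<close>

definition poly_span :: "'a::field set \<Rightarrow> 'a set \<Rightarrow> nat \<Rightarrow> 'a set" where
  "poly_span K V D = {(\<Sum>m\<in>PiE V (\<lambda>_. {..D}). c m * (\<Prod>v\<in>V. v ^ m v)) | c. \<forall>m. c m \<in> K}"

context
  fixes K V :: "'a::field set"
  assumes K: "is_subfield K" and V: "finite V"
begin

lemma finite_exponents: "finite (PiE V (\<lambda>_. {..D::nat}))"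
  using V by (intro finite_PiE) auto

lemma poly_span_monomial:
  assumes "c \<in> K" "\<And>v. v \<in> V \<Longrightarrow> m v \<le> D"
  shows "c * (\<Prod>v\<in>V. v ^ m v) \<in> poly_span K V D"
proof -
  define m' where "m' = restrict m V"
  define C where "C = (\<lambda>n. if n = m' then c else 0)"
  have m': "m' \<in> PiE V (\<lambda>_. {..D})" using assms(2) by (auto simp: m'_def)
  have "(\<Sum>n\<in>PiE V (\<lambda>_. {..D}). C n * (\<Prod>v\<in>V. v ^ n v)) = (\<Sum>n\<in>{m'}. C n * (\<Prod>v\<in>V. v ^ n v))"
    using m' finite_exponents by (intro sum.mono_neutral_right) (auto simp: C_def)
  also have "\<dots> = c * (\<Prod>v\<in>V. v ^ m v)" by (simp add: C_def m'_def)
  finally have "c * (\<Prod>v\<in>V. v ^ m v) = (\<Sum>n\<in>PiE V (\<lambda>_. {..D}). C n * (\<Prod>v\<in>V. v ^ n v))" by simp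
  moreover have "\<forall>n. C n \<in> K" using assms(1) is_subfield_0[OF K] by (simp add: C_def)
  ultimately show ?thesis unfolding poly_span_def by blast
qed

lemma poly_span_add:
  assumes "x \<in> poly_span K V D" "y \<in> poly_span K V D"
  shows "x + y \<in> poly_span K V D"
proof -
  obtain b c where b: "x = (\<Sum>m\<in>PiE V (\<lambda>_. {..D}). b m * (\<Prod>v\<in>V. v ^ m v))" "\<forall>m. b m \<in> K"
    and c: "y = (\<Sum>m\<in>PiE V (\<lambda>_. {..D}). c m * (\<Prod>v\<in>V. v ^ m v))" "\<forall>m. c m \<in> K"
    using assms unfolding poly_span_def by blast
  have "x + y = (\<Sum>m\<in>PiE V (\<lambda>_. {..D}). (b m + c m) * (\<Prod>v\<in>V. v ^ m v))"
    unfolding b(1) c(1) by (simp add: sum.distrib distrib_right)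
  moreover have "\<forall>m. b m + c m \<in> K" using b(2) c(2) is_subfield_add[OF K] by blast
  ultimately show ?thesis unfolding poly_span_def by (intro CollectI exI[of _ "\<lambda>m. b m + c m"] conjI)
qed

lemma poly_span_const: "c \<in> K \<Longrightarrow> c \<in> poly_span K V D"
  using poly_span_monomial[of c "\<lambda>_. 0" D] by simp

lemma poly_span_sum: "(\<And>i. i \<in> I \<Longrightarrow> g i \<in> poly_span K V D) \<Longrightarrow> (\<Sum>i\<in>I. g i) \<in> poly_span K V D"
  by (induction I rule: infinite_finite_induct)
    (auto intro: poly_span_add poly_span_const is_subfield_0[OF K])

lemma poly_span_mult:
  assumes "x \<in> poly_span K V D" "y \<in> poly_span K V D'"
  shows "x * y \<in> poly_span K V (D + D')"
proof -
  obtain b c where b: "x = (\<Sum>m\<in>PiE V (\<lambda>_. {..D}). b m * (\<Prod>v\<in>V. v ^ m v))" "\<forall>m. b m \<in> K"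
    and c: "y = (\<Sum>m\<in>PiE V (\<lambda>_. {..D'}). c m * (\<Prod>v\<in>V. v ^ m v))" "\<forall>m. c m \<in> K"
    using assms unfolding poly_span_def by blast
  have "x * y = (\<Sum>m\<in>PiE V (\<lambda>_. {..D}). \<Sum>n\<in>PiE V (\<lambda>_. {..D'}). (b m * c n) * (\<Prod>v\<in>V. v ^ (m v + n v)))"
    unfolding b(1) c(1) sum_product by (intro sum.cong refl) (simp add: power_add prod.distrib mult_ac)
  also have "\<dots> \<in> poly_span K V (D + D')"
  proof (intro poly_span_sum poly_span_monomial)
    fix m n v assume "m \<in> PiE V (\<lambda>_. {..D})" "n \<in> PiE V (\<lambda>_. {..D'})" "v \<in> V"
    then have "m v \<le> D" "n v \<le> D'" by (auto dest: PiE_mem)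
    then show "m v + n v \<le> D + D'" by simp
  qed (use b(2) c(2) is_subfield_mult[OF K] in blast)
  finally show ?thesis .
qed

lemma poly_span_power: "x \<in> poly_span K V D \<Longrightarrow> x ^ n \<in> poly_span K V (n * D)"
  by (induction n) (auto intro: poly_span_mult poly_span_const is_subfield_1[OF K])

lemma poly_span_prod:
  "(\<And>i. i \<in> I \<Longrightarrow> g i \<in> poly_span K V D) \<Longrightarrow> (\<Prod>i\<in>I. g i) \<in> poly_span K V (card I * D)"
  by (induction I rule: infinite_finite_induct)
    (auto intro: poly_span_mult poly_span_const is_subfield_1[OF K])

lemma poly_span_generator:
  assumes "w \<in> V"
  shows "w \<in> poly_span K V 1"
proof -
  have "(\<Prod>v\<in>V. v ^ (if v = w then 1 else 0 :: nat)) = (\<Prod>v\<in>V. if v = w then w else 1)"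
    by (intro prod.cong) auto
  also have "\<dots> = w" using assms V by simp
  finally show ?thesis
    using poly_span_monomial[of 1 "\<lambda>v. if v = w then 1 else 0" 1] is_subfield_1[OF K] by simp
qed

lemma poly_span_quotient:
  assumes "y \<in> field_adjoin K V"
  shows "\<exists>D p q. p \<in> poly_span K V D \<and> q \<in> poly_span K V D \<and> q \<noteq> 0 \<and> y = p / q"
  using assms
proof (induction rule: field_adjoin_induct)
  case one
  show ?case using poly_span_const[OF is_subfield_1[OF K], of 0]
    by (intro exI[of _ 0] exI[of _ 1]) auto
next
  case (base x)
  have "x \<in> poly_span K V 1" using base poly_span_const poly_span_generator by blast
  then show ?case using poly_span_const[OF is_subfield_1[OF K], of 1]
    by (intro exI[of _ "1::nat"] exI[of _ x] exI[of _ 1]) auto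
next
  case (uminus x)
  then obtain D p q where x: "p \<in> poly_span K V D" "q \<in> poly_span K V D" "q \<noteq> 0" "x = p / q" by blast
  have "(-1) * p \<in> poly_span K V (0 + D)"
    by (intro poly_span_mult poly_span_const is_subfield_uminus[OF K] is_subfield_1[OF K] x)
  then show ?case using x by (intro exI[of _ D] exI[of _ "-p"] exI[of _ q]) auto
next
  case (inverse x)
  then obtain D p q where x: "p \<in> poly_span K V D" "q \<in> poly_span K V D" "q \<noteq> 0" "x = p / q" by blast
  then show ?case using inverse by (intro exI[of _ D] exI[of _ q] exI[of _ p]) auto
next
  case (add x y)
  then obtain D p q D' p' q' where x: "p \<in> poly_span K V D" "q \<in> poly_span K V D" "q \<noteq> 0" "x = p / q"
    and y: "p' \<in> poly_span K V D'" "q' \<in> poly_span K V D'" "q' \<noteq> 0" "y = p' / q'" by blast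
  have "p * q' + q * p' \<in> poly_span K V (D + D')" "q * q' \<in> poly_span K V (D + D')"
    using x y by (auto intro: poly_span_add poly_span_mult)
  moreover have "x + y = (p * q' + q * p') / (q * q')" using x y by (simp add: add_frac_eq mult.commute)
  ultimately show ?case using x(3) y(3) by (metis no_zero_divisors)
next
  case (mult x y)
  then obtain D p q D' p' q' where x: "p \<in> poly_span K V D" "q \<in> poly_span K V D" "q \<noteq> 0" "x = p / q"
    and y: "p' \<in> poly_span K V D'" "q' \<in> poly_span K V D'" "q' \<noteq> 0" "y = p' / q'" by blast
  have "p * p' \<in> poly_span K V (D + D')" "q * q' \<in> poly_span K V (D + D')"
    using x y by (auto intro: poly_span_mult)
  moreover have "x * y = (p * p') / (q * q')" using x y by simp
  ultimately show ?case using x(3) y(3) by (metis no_zero_divisors)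
qed

lemma poly_span_common_denominator:
  assumes "finite S" "S \<subseteq> field_adjoin K V"
  shows "\<exists>D P Q. Q \<noteq> 0 \<and> Q \<in> poly_span K V D \<and> (\<forall>s\<in>S. P s \<in> poly_span K V D \<and> s * Q = P s)"
  using assms
proof (induction S rule: finite_induct)
  case empty
  show ?case using poly_span_const[OF is_subfield_1[OF K], of 0] by (intro exI[of _ 0] exI[of _ "\<lambda>_. 0"] exI[of _ 1]) auto
next
  case (insert y S)
  then have "\<exists>D P Q. Q \<noteq> 0 \<and> Q \<in> poly_span K V D \<and> (\<forall>s\<in>S. P s \<in> poly_span K V D \<and> s * Q = P s)"
    by simp
  then obtain D P Q where PQ: "Q \<noteq> 0" "Q \<in> poly_span K V D" "\<And>s. s \<in> S \<Longrightarrow> P s \<in> poly_span K V D" "\<And>s. s \<in> S \<Longrightarrow> s * Q = P s"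
    by blast
  obtain D' p q where y: "p \<in> poly_span K V D'" "q \<in> poly_span K V D'" "q \<noteq> 0" "y = p / q"
    using poly_span_quotient insert.prems by blast
  define P' where "P' = (\<lambda>s. if s = y then p * Q else P s * q)"
  have "Q * q \<in> poly_span K V (D + D')" "Q * q \<noteq> 0" using PQ y by (auto intro: poly_span_mult)
  moreover have "P' s \<in> poly_span K V (D + D')" if "s \<in> insert y S" for s
    unfolding P'_def using that PQ(2,3) y(1,2) poly_span_mult[of p D' Q D] poly_span_mult[of "P s" D q D']
    by (auto simp: add.commute)
  moreover have "s * (Q * q) = P' s" if "s \<in> insert y S" for s
  proof (cases "s = y")
    case False
    then have "s * Q = P s" using that PQ(4) by auto
    then show ?thesis using False by (simp add: P'_def flip: mult.assoc)
  qed (use y in \<open>simp add: P'_def\<close>)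
  ultimately show ?case by blast
qed

text \<open>For \<open>N\<close> large, the \<open>(N + 1)\<^bsup>card S\<^esup>\<close> monomials in \<open>S\<close>, multiplied by a common
  denominator, outnumber the \<open>O(N\<^bsup>card V\<^esup>)\<close> monomials in \<open>V\<close> that span them.\<close>

lemma monomial_relation:
  assumes S: "finite S" "S \<subseteq> field_adjoin K V" "card V < card S"
  shows "\<exists>(N::nat) c. (\<forall>m. c m \<in> K) \<and> (\<exists>m\<in>PiE S (\<lambda>_. {..N}). c m \<noteq> 0) \<and>
    (\<Sum>m\<in>PiE S (\<lambda>_. {..N}). c m * (\<Prod>s\<in>S. s ^ m s)) = 0"
proof -
  obtain D P Q where Q: "Q \<noteq> 0" "Q \<in> poly_span K V D" and P: "\<And>s. s \<in> S \<Longrightarrow> P s \<in> poly_span K V D" "\<And>s. s \<in> S \<Longrightarrow> s * Q = P s"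
    using poly_span_common_denominator[OF S(1,2)] by blast
  \<comment> \<open>\<open>C\<close> gives \<open>R + 1 <= C * (N + 1)\<close>, and then
    \<open>N = C ^ card V\<close> gives \<open>(R + 1) ^ card V <= N * (N + 1) ^ card V\<close>,
    just below \<open>(N + 1) ^ Suc (card V)\<close>.\<close>
  define C where "C = card S * D + 1"
  define N where "N = C ^ card V"
  define R where "R = card S * (N * D)"
  have count: "card (PiE V (\<lambda>_. {..R})) < card (PiE S (\<lambda>_. {..N}))"
  proof -
    have "R + 1 \<le> C * (N + 1)" by (simp add: R_def C_def algebra_simps)
    then have "(R + 1) ^ card V \<le> (C * (N + 1)) ^ card V" by (rule power_mono) simp
    also have "\<dots> = N * (N + 1) ^ card V" by (simp only: power_mult_distrib N_def)
    also have "\<dots> < (N + 1) ^ Suc (card V)" by simp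
    also have "\<dots> \<le> (N + 1) ^ card S" using S(3) by (intro power_increasing) auto
    finally show ?thesis using V S(1) by (simp add: card_PiE)
  qed
  \<comment> \<open>A factor \<open>Q ^ N\<close> for each \<open>s\<close> in \<open>S\<close>
    clears \<open>s ^ m s\<close> and leaves \<open>Q ^ (N - m s)\<close>, so one power of
    \<open>Q\<close> serves all monomials.\<close>
  define M where "M = N * card S"
  have "\<exists>A. (\<forall>n. A n \<in> K) \<and> (\<Prod>s\<in>S. s ^ m s) * Q ^ M = (\<Sum>n\<in>PiE V (\<lambda>_. {..R}). A n * (\<Prod>v\<in>V. v ^ n v))"
    if m: "m \<in> PiE S (\<lambda>_. {..N})" for m
  proof -
    have "(\<Prod>s\<in>S. s ^ m s) * Q ^ M = (\<Prod>s\<in>S. s ^ m s * Q ^ N)"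
      using S(1) by (simp add: prod.distrib M_def power_mult)
    also have "\<dots> = (\<Prod>s\<in>S. P s ^ m s * Q ^ (N - m s))"
    proof (intro prod.cong refl)
      fix s assume s: "s \<in> S"
      then have "m s \<le> N" using m by (auto dest: PiE_mem)
      then have "Q ^ N = Q ^ m s * Q ^ (N - m s)" by (simp flip: power_add)
      then show "s ^ m s * Q ^ N = P s ^ m s * Q ^ (N - m s)"
        using P(2)[OF s] by (simp add: mult.assoc flip: power_mult_distrib)
    qed
    also have "\<dots> \<in> poly_span K V R" unfolding R_def
    proof (intro poly_span_prod)
      fix s assume s: "s \<in> S"
      then have "m s \<le> N" using m by (auto dest: PiE_mem)
      then have "m s * D + (N - m s) * D = N * D" by (simp flip: add_mult_distrib)
      then show "P s ^ m s * Q ^ (N - m s) \<in> poly_span K V (N * D)"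
        using poly_span_mult[OF poly_span_power[OF P(1)[OF s], of "m s"] poly_span_power[OF Q(2), of "N - m s"]] by simp
    qed
    finally show ?thesis unfolding poly_span_def by blast
  qed
  then have "\<forall>m\<in>PiE S (\<lambda>_. {..N}). \<exists>A. (\<forall>n. A n \<in> K) \<and>
      (\<Prod>s\<in>S. s ^ m s) * Q ^ M = (\<Sum>n\<in>PiE V (\<lambda>_. {..R}). A n * (\<Prod>v\<in>V. v ^ n v))" by blast
  from bchoice[OF this] obtain A where A: "\<And>m n. m \<in> PiE S (\<lambda>_. {..N}) \<Longrightarrow> A m n \<in> K"
    "\<And>m. m \<in> PiE S (\<lambda>_. {..N}) \<Longrightarrow> (\<Prod>s\<in>S. s ^ m s) * Q ^ M = (\<Sum>n\<in>PiE V (\<lambda>_. {..R}). A m n * (\<Prod>v\<in>V. v ^ n v))"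
    by blast
  \<comment> \<open>Unknowns are indexed by monomials in \<open>S\<close>, equations by monomials in
    \<open>V\<close>, whose coefficients must all vanish.\<close>
  have "\<exists>c. (\<forall>m. c m \<in> K) \<and> (\<exists>m\<in>PiE S (\<lambda>_. {..N}). c m \<noteq> 0) \<and>
     (\<forall>n\<in>PiE V (\<lambda>_. {..R}). (\<Sum>m\<in>PiE S (\<lambda>_. {..N}). A m n * c m) = 0)"
    using count A(1) V S(1) by (intro homogeneous_system_nontrivial_solution[OF K] finite_PiE) auto
  then obtain c where c: "\<forall>m. c m \<in> K" "\<exists>m\<in>PiE S (\<lambda>_. {..N}). c m \<noteq> 0"
    "\<And>n. n \<in> PiE V (\<lambda>_. {..R}) \<Longrightarrow> (\<Sum>m\<in>PiE S (\<lambda>_. {..N}). A m n * c m) = 0" by blast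
  have "(\<Sum>m\<in>PiE S (\<lambda>_. {..N}). c m * (\<Prod>s\<in>S. s ^ m s)) * Q ^ M
      = (\<Sum>m\<in>PiE S (\<lambda>_. {..N}). \<Sum>n\<in>PiE V (\<lambda>_. {..R}). (A m n * c m) * (\<Prod>v\<in>V. v ^ n v))"
    unfolding sum_distrib_right
  proof (intro sum.cong refl)
    fix m assume m: "m \<in> PiE S (\<lambda>_. {..N})"
    have "c m * (\<Prod>s\<in>S. s ^ m s) * Q ^ M = c m * (\<Sum>n\<in>PiE V (\<lambda>_. {..R}). A m n * (\<Prod>v\<in>V. v ^ n v))"
      by (simp only: mult.assoc A(2)[OF m])
    also have "\<dots> = (\<Sum>n\<in>PiE V (\<lambda>_. {..R}). (A m n * c m) * (\<Prod>v\<in>V. v ^ n v))"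
      unfolding sum_distrib_left by (intro sum.cong refl) (simp only: mult_ac)
    finally show "c m * (\<Prod>s\<in>S. s ^ m s) * Q ^ M = (\<Sum>n\<in>PiE V (\<lambda>_. {..R}). (A m n * c m) * (\<Prod>v\<in>V. v ^ n v))" .
  qed
  also have "\<dots> = (\<Sum>n\<in>PiE V (\<lambda>_. {..R}). (\<Sum>m\<in>PiE S (\<lambda>_. {..N}). A m n * c m) * (\<Prod>v\<in>V. v ^ n v))"
    unfolding sum_distrib_right by (rule sum.swap)
  also have "\<dots> = 0" using c(3) by simp
  finally have "(\<Sum>m\<in>PiE S (\<lambda>_. {..N}). c m * (\<Prod>s\<in>S. s ^ m s)) = 0" using Q(1) by simp
  then show ?thesis using c(1,2) by blast
qed

lemma card_le_if_alg_independent: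
  assumes S: "finite S" "S \<subseteq> field_adjoin K V" "alg_independent K S (\<lambda>s. s)"
  shows "card S \<le> card V"
proof (rule ccontr)
  assume "\<not> card S \<le> card V"
  then have "card V < card S" by simp
  from monomial_relation[OF S(1,2) this]
  obtain N :: nat and c where c: "\<forall>m. c m \<in> K" "\<exists>m\<in>PiE S (\<lambda>_. {..N}). c m \<noteq> 0"
    "(\<Sum>m\<in>PiE S (\<lambda>_. {..N}). c m * (\<Prod>s\<in>S. s ^ m s)) = 0" by blast
  define U where "U = PiE S (\<lambda>_. {..N})"
  have finU: "finite U" unfolding U_def using S(1) by (intro finite_PiE) auto
  \<comment> \<open>Extensional exponent functions are \<open>undefined\<close> off
    \<open>S\<close>, whereas exponents of a polynomial must be 0 there; \<open>ex\<close> converts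
    and \<open>restrict\<close> converts back.\<close>
  define ex where "ex = (\<lambda>m. Abs_poly_mapping (\<lambda>s. if s \<in> S then m s else (0::nat)))"
  have lookup_ex: "Poly_Mapping.lookup (ex m) = (\<lambda>s. if s \<in> S then m s else 0)" for m
    unfolding ex_def by (intro lookup_Abs_poly_mapping finite_subset[OF _ S(1)]) auto
  have keys_ex: "Poly_Mapping.keys (ex m) \<subseteq> S" for m
    by (auto simp: in_keys_iff lookup_ex split: if_splits)
  have restrict_ex: "restrict (Poly_Mapping.lookup (ex m)) S = m" if "m \<in> U" for m
  proof
    fix s show "restrict (Poly_Mapping.lookup (ex m)) S s = m s"
    proof (cases "s \<in> S")
      case False
      then have "m s = undefined" using that unfolding U_def by (rule PiE_arb[rotated])
      then show ?thesis using False by simp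
    qed (simp add: lookup_ex)
  qed
  have inj: "inj_on ex U" by (rule inj_on_inverseI[OF restrict_ex])
  define p where "p = Abs_poly_mapping (\<lambda>e. if e \<in> ex ` U then c (restrict (Poly_Mapping.lookup e) S) else 0)"
  have lookup_p: "Poly_Mapping.lookup p = (\<lambda>e. if e \<in> ex ` U then c (restrict (Poly_Mapping.lookup e) S) else 0)"
    unfolding p_def by (intro lookup_Abs_poly_mapping finite_subset[OF _ finite_imageI[OF finU, of ex]]) auto
  have keys_p: "Poly_Mapping.keys p \<subseteq> ex ` U"
    by (auto simp: in_keys_iff lookup_p split: if_splits)
  have "mpoly_eval (\<lambda>s. s) p = (\<Sum>e\<in>ex ` U. Poly_Mapping.lookup p e * (\<Prod>s\<in>Poly_Mapping.keys e. s ^ Poly_Mapping.lookup e s))"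
    unfolding mpoly_eval_def using keys_p finU by (intro sum.mono_neutral_left) (auto simp: in_keys_iff)
  also have "\<dots> = (\<Sum>m\<in>U. c m * (\<Prod>s\<in>S. s ^ m s))"
    unfolding sum.reindex[OF inj] o_def
  proof (intro sum.cong refl arg_cong2[of _ _ _ _ times])
    fix m assume m: "m \<in> U"
    show "Poly_Mapping.lookup p (ex m) = c m" using m by (simp add: lookup_p restrict_ex)
    have "(\<Prod>s\<in>Poly_Mapping.keys (ex m). s ^ Poly_Mapping.lookup (ex m) s) = (\<Prod>s\<in>S. s ^ Poly_Mapping.lookup (ex m) s)"
      using keys_ex S(1) by (intro prod.mono_neutral_left) (auto simp: in_keys_iff)
    also have "\<dots> = (\<Prod>s\<in>S. s ^ m s)" by (simp add: lookup_ex)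
    finally show "(\<Prod>s\<in>Poly_Mapping.keys (ex m). s ^ Poly_Mapping.lookup (ex m) s) = (\<Prod>s\<in>S. s ^ m s)" .
  qed
  also have "\<dots> = 0" using c(3) by (simp add: U_def)
  finally have eval0: "mpoly_eval (\<lambda>s. s) p = 0" .
  have "\<forall>e\<in>Poly_Mapping.keys p. Poly_Mapping.lookup p e \<in> K \<and> Poly_Mapping.keys e \<subseteq> S"
    using keys_p keys_ex c(1) is_subfield_0[OF K] by (auto simp: lookup_p)
  then have "p = 0" using S(3) eval0 unfolding alg_independent_def by blast
  moreover obtain m where m: "m \<in> U" "c m \<noteq> 0" using c(2) by (auto simp: U_def)
  then have "Poly_Mapping.lookup p (ex m) \<noteq> 0" by (simp add: lookup_p restrict_ex)
  ultimately show False by simp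
qed

text \<open>\<open>V\<close> itself attains the supremum, and the dimension count bounds every
  competitor.\<close>

lemma trdeg_field_adjoin_eq:
  assumes "alg_independent K V (\<lambda>s. s)"
  shows "trdeg K (field_adjoin K V) = enat (card V)"
  unfolding trdeg_def
proof (rule antisym)
  show "(SUP S\<in>{S. finite S \<and> S \<subseteq> field_adjoin K V \<and> alg_independent K S (\<lambda>s. s)}. enat (card S)) \<le> enat (card V)"
    using card_le_if_alg_independent by (intro SUP_least) auto
  show "enat (card V) \<le> (SUP S\<in>{S. finite S \<and> S \<subseteq> field_adjoin K V \<and> alg_independent K S (\<lambda>s. s)}. enat (card S))"
    using assms V field_adjoin_superset[of K V] by (intro SUP_upper) auto
qed

end

section \<open>Generating functions of regular sequences\<close>

lemma gen_fun_inj: "gen_fun f = gen_fun g \<Longrightarrow> f = g"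
proof -
  assume "gen_fun f = gen_fun g"
  then have "Abs_fps (\<lambda>n. complex_of_int (f n)) = Abs_fps (\<lambda>n. of_int (g n))"
    by (simp add: gen_fun_def)
  then have "complex_of_int (f n) = of_int (g n)" for n by (metis fps_nth_Abs_fps)
  then show "f = g" by (intro ext) simp
qed

text \<open>On the real segment the complex series is a real series of nonnegative terms, so the
  Abelian limit carries over and summability there gives the radius.\<close>

lemma k_regular_has_log_order:
  fixes f :: "nat \<Rightarrow> int"
  defines "G \<equiv> Abs_fps (\<lambda>n. complex_of_int (f n))"
  assumes "k_regular k f" "k \<ge> 2" "\<And>n. f n \<ge> 0" "\<not> (\<forall>\<^sub>F n in sequentially. f n = 0)"
  shows "fps_conv_radius G \<ge> 1"
    and "has_log_order (\<lambda>r. eval_fps G (of_real r)) (log (real k) (growth_base k f))"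
proof -
  define \<beta> where "\<beta> = log (real k) (growth_base k f)"
  have gb: "has_growth_base k f (growth_base k f)"
    using assms(2-) by (rule has_growth_base_growth_base)
  have lim: "(\<lambda>N. ln (\<Sum>n\<le>N. real_of_int (f n)) / ln (real N)) \<longlonglongrightarrow> \<beta>"
    unfolding \<beta>_def using gb by (rule has_growth_base_log_limit)
  have "growth_base k f \<ge> 1" using gb by (simp add: has_growth_base_def)
  then have \<beta>: "\<beta> \<ge> 0" using assms(3) by (simp add: \<beta>_def)
  have pos: "\<forall>\<^sub>F N in sequentially. (\<Sum>n\<le>N. real_of_int (f n)) > 0"
    using partial_sums_at_top[OF assms(4,5)] by (simp add: filterlim_at_top_dense)
  have nonneg: "real_of_int (f n) \<ge> 0" for n using assms(4) by simp
  note abel = abelian_log_limit[of "\<lambda>n. real_of_int (f n)", OF nonneg lim \<beta> pos]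
  have cs: "(\<lambda>n. complex_of_int (f n) * of_real r ^ n) = (\<lambda>n. complex_of_real (real_of_int (f n) * r ^ n))" for r
    by simp
  show "fps_conv_radius G \<ge> 1"
    unfolding fps_conv_radius_def
  proof (rule conv_radius_geI_ex')
    fix r :: real assume "0 < r" "ereal r < 1"
    then have "summable (\<lambda>n. real_of_int (f n) * r ^ n)" by (intro abel(1)) auto
    then show "summable (\<lambda>n. fps_nth G n * complex_of_real r ^ n)"
      unfolding G_def fps_nth_Abs_fps cs by (rule summable_of_real)
  qed
  have ev: "eval_fps G (of_real r) = of_real (suminf (\<lambda>n. real_of_int (f n) * r ^ n))" if "0 < r" "r < 1" for r
    unfolding eval_fps_def G_def fps_nth_Abs_fps cs using abel(1)[OF that] by (rule suminf_of_real[symmetric])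
  have x01: "\<forall>\<^sub>F x::real in at_left 1. 0 < x \<and> x < 1"
    using eventually_at_left_real[of 0 "1::real"] by (auto elim: eventually_mono)
  have "((\<lambda>r. ln (norm (eval_fps G (of_real r))) / ln (1 / (1 - r))) \<longlongrightarrow> \<beta>) (at_left 1)"
    using abel(3)
  proof (rule Lim_transform_eventually)
    show "\<forall>\<^sub>F r in at_left 1. ln (suminf (\<lambda>n. real_of_int (f n) * r ^ n)) / ln (1 / (1 - r))
        = ln (norm (eval_fps G (of_real r))) / ln (1 / (1 - r))"
      using x01 abel(2) by eventually_elim (simp add: ev)
  qed
  moreover have "\<forall>\<^sub>F r in at_left 1. eval_fps G (of_real r) \<noteq> 0"
    using x01 abel(2)
  proof eventually_elim
    case (elim r)
    then show ?case by (simp add: ev)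
  qed
  ultimately show "has_log_order (\<lambda>r. eval_fps G (of_real r)) (log (real k) (growth_base k f))"
    by (simp add: has_log_order_def \<beta>_def)
qed

text \<open>Multiplying by \<open>ln k\<close> and exponentiating turns the additive relation into a
  product of powers equal to 1; \<open>n\<close> becomes the exponent of \<open>k\<close>, at index
  0.\<close>

lemma mult_independent_log:
  fixes \<alpha> :: "nat \<Rightarrow> real" and e :: "nat \<Rightarrow> int" and n :: int
  assumes "mult_independent {0..d} (\<lambda>i. if i = 0 then real k else \<alpha> i)" "k \<ge> 2"
    and pos: "\<And>i. i \<in> {1..d} \<Longrightarrow> \<alpha> i > 0"
    and sum: "of_int n + (\<Sum>i\<in>{1..d}. of_int (e i) * log (real k) (\<alpha> i)) = 0"
  shows "\<forall>i\<in>{1..d}. e i = 0"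
proof -
  define e' where "e' = (\<lambda>i. if i = 0 then n else e i)"
  have powi: "x powi j = exp (of_int j * ln x)" if "x > 0" for x :: real and j
  proof -
    have "x powi j = x powr of_int j" using that by (intro powr_real_of_int'[symmetric]) auto
    then show ?thesis using that by (simp add: powr_def)
  qed
  have k: "real k > 0" "ln (real k) > 0" using assms(2) by auto
  have "(\<Prod>i\<in>{0..d}. (if i = 0 then real k else \<alpha> i) powi e' i) = real k powi n * (\<Prod>i\<in>{1..d}. \<alpha> i powi e i)"
    by (simp add: prod.atLeast_Suc_atMost e'_def)
  also have "(\<Prod>i\<in>{1..d}. \<alpha> i powi e i) = (\<Prod>i\<in>{1..d}. exp (of_int (e i) * ln (\<alpha> i)))"
    using pos by (intro prod.cong powi refl)
  also have "\<dots> = exp (\<Sum>i\<in>{1..d}. of_int (e i) * ln (\<alpha> i))" by (simp add: exp_sum)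
  also have "real k powi n * \<dots> = exp (of_int n * ln (real k) + (\<Sum>i\<in>{1..d}. of_int (e i) * ln (\<alpha> i)))"
    using k by (simp add: powi exp_add)
  also have "of_int n * ln (real k) + (\<Sum>i\<in>{1..d}. of_int (e i) * ln (\<alpha> i))
     = (of_int n + (\<Sum>i\<in>{1..d}. of_int (e i) * log (real k) (\<alpha> i))) * ln (real k)"
    using k unfolding distrib_right sum_distrib_right by (simp add: log_def)
  finally have "(\<Prod>i\<in>{0..d}. (if i = 0 then real k else \<alpha> i) powi e' i) = 1" using sum by simp
  then have "\<forall>i\<in>{0..d}. e' i = 0" using assms(1) unfolding mult_independent_def by blast
  then have "e' i = 0" if "i \<in> {1..d}" for i using that by auto
  then show ?thesis by (auto simp: e'_def)
qed

theorem theorem3: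
  fixes k d :: nat
    and f :: "nat \<Rightarrow> nat \<Rightarrow> int"
    and F :: "nat \<Rightarrow> complex fls"
  assumes "k \<ge> 2"
    and "\<And>i. i \<in> {1..d} \<Longrightarrow> k_regular k (f i)"
    and "\<And>i n. i \<in> {1..d} \<Longrightarrow> f i n \<ge> 0"
    and "\<And>i. i \<in> {1..d} \<Longrightarrow> \<not> (\<forall>\<^sub>F n in sequentially. f i n = 0)"
    and "\<And>i. i \<in> {1..d} \<Longrightarrow> F i = gen_fun (f i)"
    and "mult_independent {0..d} (\<lambda>i. if i = 0 then real k else growth_base k (f i))"
  shows "trdeg (field_adjoin rational_functions meromorphic_functions)
           (field_adjoin (field_adjoin rational_functions meromorphic_functions) (F ` {1..d})) = enat d
         \<and> alg_independent rational_functions {1..d} F"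
proof -
  define K where "K = field_adjoin rational_functions meromorphic_functions"
  define G where "G = (\<lambda>i. Abs_fps (\<lambda>n. complex_of_int (f i n)))"
  define a where "a = (\<lambda>i. log (real k) (growth_base k (f i)))"
  have FG: "F i = fps_to_fls (G i)" if "i \<in> {1..d}" for i
    using assms(5)[OF that] by (simp add: gen_fun_def G_def)
  have radius: "fps_conv_radius (G i) \<ge> 1" if "i \<in> {1..d}" for i
    unfolding G_def using assms(2)[OF that] assms(1) assms(3)[OF that] assms(4)[OF that]
    by (rule k_regular_has_log_order(1))
  have order: "has_log_order (\<lambda>r. eval_fps (G i) (of_real r)) (a i)" if "i \<in> {1..d}" for i
    unfolding G_def a_def using assms(2)[OF that] assms(1) assms(3)[OF that] assms(4)[OF that]
    by (rule k_regular_has_log_order(2))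
  have pos: "growth_base k (f i) > 0" if "i \<in> {1..d}" for i
    using has_growth_base_growth_base[OF assms(2)[OF that] assms(1) assms(3)[OF that] assms(4)[OF that]]
    by (simp add: has_growth_base_def)
  have indep: "\<forall>i\<in>{1..d}. e i = 0"
    if "of_int n + (\<Sum>i\<in>{1..d}. of_int (e i) * a i) = 0" for e :: "nat \<Rightarrow> int" and n :: int
    by (rule mult_independent_log[OF assms(6,1) pos that[unfolded a_def]])
  have K: "K \<subseteq> entire_quotients" unfolding K_def by (rule field_adjoin_subset_entire_quotients)
  \<comment> \<open>Equal generating functions come from equal sequences, and then the exponents
    \<open>1\<close> and \<open>-1\<close> contradict independence. Injectivity guarantees that the
    generating set has \<open>d\<close> elements.\<close>
  have inj: "inj_on F {1..d}"
  proof (rule inj_onI, rule ccontr)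
    fix i j assume ij: "i \<in> {1..d}" "j \<in> {1..d}" "F i = F j" "i \<noteq> j"
    then have "f i = f j" using assms(5) by (intro gen_fun_inj) simp
    define e :: "nat \<Rightarrow> int" where "e = (\<lambda>l. if l = i then 1 else if l = j then -1 else 0)"
    have "(\<Sum>l\<in>{1..d}. of_int (e l) * a l) = (\<Sum>l\<in>{i, j}. of_int (e l) * a l)"
      using ij by (intro sum.mono_neutral_right) (auto simp: e_def)
    also have "\<dots> = 0" using ij(4) \<open>f i = f j\<close> by (simp add: e_def a_def)
    finally have "e i = 0" using indep[of 0 e] ij(1) by simp
    then show False by (simp add: e_def)
  qed
  \<comment> \<open>\<open>trdeg\<close> speaks of subsets of the field, so the family is reindexed
    by its values.\<close>
  define idx where "idx = inv_into {1..d} F"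
  have idx: "idx y \<in> {1..d}" "F (idx y) = y" if "y \<in> F ` {1..d}" for y
    unfolding idx_def using inv_into_into[OF that] f_inv_into_f[OF that] by auto
  have idx_F: "idx (F i) = i" if "i \<in> {1..d}" for i
    unfolding idx_def using inj that by (rule inv_into_f_f)
  have ind: "alg_independent K (F ` {1..d}) (\<lambda>s. s)"
  proof (rule alg_independent_of_log_orders[OF K, where G = "\<lambda>y. G (idx y)" and a = "\<lambda>y. a (idx y)"])
    show "y = fps_to_fls (G (idx y))" if "y \<in> F ` {1..d}" for y using FG idx[OF that] by metis
    show "fps_conv_radius (G (idx y)) \<ge> 1" if "y \<in> F ` {1..d}" for y using radius idx(1)[OF that] .
    show "has_log_order (\<lambda>r. eval_fps (G (idx y)) (of_real r)) (a (idx y))" if "y \<in> F ` {1..d}" for y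
      using order idx(1)[OF that] .
    show "\<forall>y\<in>F ` {1..d}. e y = 0" if "of_int n + (\<Sum>y\<in>F ` {1..d}. of_int (e y) * a (idx y)) = 0"
      for e :: "complex fls \<Rightarrow> int" and n :: int
    proof -
      have "(\<Sum>y\<in>F ` {1..d}. of_int (e y) * a (idx y)) = (\<Sum>i\<in>{1..d}. of_int (e (F i)) * a i)"
        unfolding sum.reindex[OF inj] o_def by (intro sum.cong refl) (simp add: idx_F)
      then show ?thesis using indep[of n "\<lambda>i. e (F i)"] that by simp
    qed
  qed auto
  have "trdeg K (field_adjoin K (F ` {1..d})) = enat (card (F ` {1..d}))"
    using ind unfolding K_def by (intro trdeg_field_adjoin_eq is_subfield_field_adjoin) auto
  then have "trdeg K (field_adjoin K (F ` {1..d})) = enat d" using inj by (simp add: card_image)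
  \<comment> \<open>Rational functions are entire quotients, so the order criterion applies again,
    now to the family indexed by \<open>{1..d}\<close>.\<close>
  moreover have "alg_independent rational_functions {1..d} F"
    using rational_functions_subset FG radius order indep
    by (intro alg_independent_of_log_orders[where G = G and a = a]) auto
  ultimately show ?thesis unfolding K_def by blast
qed

end
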